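(* Let $\Bbbk$ be a field of arbitrary characteristic. Let $R$ and $S$ be standard graded polynomial rings over $\Bbbk$ with $\dim R\ge 1$, $\dim S\ge 1$ and graded maximal ideals $\mathfrak m$ and $\mathfrak n$, and let $T=R\otimes_\Bbbk S$. Let $I\subseteq\mathfrak m^2$ and $J\subseteq\mathfrak n^2$ be homogeneous ideals of $R$ and $S$, respectively, and let $F=I+J+\mathfrak m\mathfrak n\subseteq T$. (1) Assume that $\min\{\operatorname{depth}(R/I),\operatorname{depth}(S/J)\}\ge 1$. Then for every integer $s\ge 1$, $F^{(s)}=(I+\mathfrak n)^{(s)}\cap (J+\mathfrak m)^{(s)}$. (2) Assume that $\min\{\operatorname{depth}(R/I),\operatorname{depth}(S/J)\}=0$. Then for every integer $s\ge 1$, $F^{(s)}=F^s$.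
   Context: Ideals of $R$ and $S$ are identified with their extensions to $T$; in particular $I+\mathfrak n$ and $J+\mathfrak m$ are ideals of $T$. For an ideal $K$ of a noetherian ring $A$ and $s\ge 1$, the $s$-th symbolic power is defined via associated primes: $K^{(s)}=\bigcap_{P\in \operatorname{Ass}(A/K)}(K^sA_P\cap A)$. Depth is taken with respect to the graded maximal ideal. *)

theory Defs
  imports
    "HOL-Algebra.Algebra"
    "HOL-Algebra.Algebraic_Closure_Type"
    "HOL-Library.Poly_Mapping"
    "HOL-Library.Extended_Nat"
begin

section \<open>Localization of a commutative ring\<close>

definition loc_frac_rel ::
  "('a, 'b) ring_scheme \<Rightarrow> 'a set \<Rightarrow> (('a \<times> 'a) \<times> ('a \<times> 'a)) set" where
  "loc_frac_rel A U = {((a, u), (b, v)) | a u b v.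
     a \<in> carrier A \<and> u \<in> U \<and> b \<in> carrier A \<and> v \<in> U \<and>
     (\<exists>w\<in>U. w \<otimes>\<^bsub>A\<^esub> (a \<otimes>\<^bsub>A\<^esub> v \<ominus>\<^bsub>A\<^esub> b \<otimes>\<^bsub>A\<^esub> u) = \<zero>\<^bsub>A\<^esub>)}"

definition loc_frac :: "('a, 'b) ring_scheme \<Rightarrow> 'a set \<Rightarrow> 'a \<Rightarrow> 'a \<Rightarrow> ('a \<times> 'a) set" where
  "loc_frac A U a u = loc_frac_rel A U `` {(a, u)}"

text \<open>The operations are given on all representatives at once, as for \<^const>\<open>rcoset_mult\<close>;
  \<open>localization_mult\<close> and \<open>localization_add\<close> below show that the result is a single fraction.\<close>

definition localization :: "('a, 'b) ring_scheme \<Rightarrow> 'a set \<Rightarrow> ('a \<times> 'a) set ring" where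
  "localization A U = \<lparr>
     carrier = (carrier A \<times> U) // loc_frac_rel A U,
     monoid.mult = (\<lambda>C D. \<Union>(a, u)\<in>C. \<Union>(b, v)\<in>D. loc_frac A U (a \<otimes>\<^bsub>A\<^esub> b) (u \<otimes>\<^bsub>A\<^esub> v)),
     one = loc_frac A U \<one>\<^bsub>A\<^esub> \<one>\<^bsub>A\<^esub>,
     ring.zero = loc_frac A U \<zero>\<^bsub>A\<^esub> \<one>\<^bsub>A\<^esub>,
     add = (\<lambda>C D. \<Union>(a, u)\<in>C. \<Union>(b, v)\<in>D.
              loc_frac A U (a \<otimes>\<^bsub>A\<^esub> v \<oplus>\<^bsub>A\<^esub> b \<otimes>\<^bsub>A\<^esub> u) (u \<otimes>\<^bsub>A\<^esub> v)) \<rparr>"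

definition local_ring_at :: "('a, 'b) ring_scheme \<Rightarrow> 'a set \<Rightarrow> ('a \<times> 'a) set ring" where
  "local_ring_at A P = localization A (carrier A - P)"

definition to_local :: "('a, 'b) ring_scheme \<Rightarrow> 'a set \<Rightarrow> 'a \<Rightarrow> ('a \<times> 'a) set" where
  "to_local A P f = loc_frac A (carrier A - P) f \<one>\<^bsub>A\<^esub>"

locale mult_subset = cring A for A (structure) +
  fixes U
  assumes U_carrier: "U \<subseteq> carrier A"
    and U_one: "\<one> \<in> U"
    and U_mult: "\<lbrakk>u \<in> U; v \<in> U\<rbrakk> \<Longrightarrow> u \<otimes> v \<in> U"
begin

lemma U_in_carrier [simp, intro]: "u \<in> U \<Longrightarrow> u \<in> carrier A"
  using U_carrier by blast

lemma loc_frac_rel_iff: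
  assumes "a \<in> carrier A" "u \<in> U" "b \<in> carrier A" "v \<in> U"
  shows "((a, u), (b, v)) \<in> loc_frac_rel A U \<longleftrightarrow> (\<exists>w\<in>U. w \<otimes> (a \<otimes> v) = w \<otimes> (b \<otimes> u))"
proof -
  have "w \<otimes> (a \<otimes> v \<ominus> b \<otimes> u) = \<zero> \<longleftrightarrow> w \<otimes> (a \<otimes> v) = w \<otimes> (b \<otimes> u)" if "w \<in> U" for w
  proof -
    have "w \<otimes> (a \<otimes> v \<ominus> b \<otimes> u) = w \<otimes> (a \<otimes> v) \<ominus> w \<otimes> (b \<otimes> u)"
      using assms that U_carrier by (auto simp: a_minus_def r_distr r_minus)
    then show ?thesis
      using assms that by (simp add: r_right_minus_eq)
  qed
  then show ?thesis
    using assms by (auto simp: loc_frac_rel_def)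
qed

lemma equiv_loc_frac_rel: "equiv (carrier A \<times> U) (loc_frac_rel A U)"
proof (rule equivI)
  show "loc_frac_rel A U \<subseteq> (carrier A \<times> U) \<times> (carrier A \<times> U)"
    by (auto simp: loc_frac_rel_def)
  show "refl_on (carrier A \<times> U) (loc_frac_rel A U)"
    using U_one by (auto simp: refl_on_def loc_frac_rel_iff)
  show "sym (loc_frac_rel A U)"
  proof (rule symI)
    fix x y assume "(x, y) \<in> loc_frac_rel A U"
    moreover from this obtain a u b v where "x = (a, u)" "y = (b, v)"
      "a \<in> carrier A" "u \<in> U" "b \<in> carrier A" "v \<in> U"
      by (auto simp: loc_frac_rel_def)
    ultimately show "(y, x) \<in> loc_frac_rel A U"
      by (auto simp: loc_frac_rel_iff) metis
  qed
  show "trans (loc_frac_rel A U)"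
  proof (rule transI)
    fix x y z assume xy: "(x, y) \<in> loc_frac_rel A U" and yz: "(y, z) \<in> loc_frac_rel A U"
    from xy obtain a u b v where 1: "x = (a, u)" "y = (b, v)"
      "a \<in> carrier A" "u \<in> U" "b \<in> carrier A" "v \<in> U"
      by (auto simp: loc_frac_rel_def)
    from yz 1 obtain c t where 2: "z = (c, t)" "c \<in> carrier A" "t \<in> U"
      by (auto simp: loc_frac_rel_def)
    from xy 1 obtain w where w: "w \<in> U" "w \<otimes> (a \<otimes> v) = w \<otimes> (b \<otimes> u)"
      by (auto simp: loc_frac_rel_iff)
    from yz 1 2 obtain w' where w': "w' \<in> U" "w' \<otimes> (b \<otimes> t) = w' \<otimes> (c \<otimes> v)"
      by (auto simp: loc_frac_rel_iff)
    have car: "w \<in> carrier A" "w' \<in> carrier A" "u \<in> carrier A" "v \<in> carrier A" "t \<in> carrier A"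
      using w w' 1 2 by auto
    have "(w \<otimes> w' \<otimes> v) \<otimes> (a \<otimes> t) = (w' \<otimes> t) \<otimes> (w \<otimes> (a \<otimes> v))"
      using car 1 2 by (simp add: m_ac)
    also have "\<dots> = (w \<otimes> u) \<otimes> (w' \<otimes> (b \<otimes> t))"
      using car 1 2 by (simp add: w m_ac)
    also have "\<dots> = (w \<otimes> w' \<otimes> v) \<otimes> (c \<otimes> u)"
      unfolding w'(2) using car 1 2 by (simp add: m_ac)
    finally show "(x, z) \<in> loc_frac_rel A U"
      using 1 2 w w' by (auto simp: loc_frac_rel_iff U_mult)
  qed
qed

lemma loc_frac_eq_iff:
  assumes "a \<in> carrier A" "u \<in> U" "b \<in> carrier A" "v \<in> U"
  shows "loc_frac A U a u = loc_frac A U b v \<longleftrightarrow> (\<exists>w\<in>U. w \<otimes> (a \<otimes> v) = w \<otimes> (b \<otimes> u))"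
  using eq_equiv_class_iff[OF equiv_loc_frac_rel, of "(a, u)" "(b, v)"] assms
  by (simp add: loc_frac_def loc_frac_rel_iff)

lemma loc_frac_memD:
  assumes "(b, v) \<in> loc_frac A U a u"
  shows "a \<in> carrier A" "u \<in> U" "b \<in> carrier A" "v \<in> U" "loc_frac A U b v = loc_frac A U a u"
proof -
  from assms have *: "((a, u), (b, v)) \<in> loc_frac_rel A U"
    by (simp add: loc_frac_def)
  then show "a \<in> carrier A" "u \<in> U" "b \<in> carrier A" "v \<in> U"
    by (auto simp: loc_frac_rel_def)
  from equiv_class_eq[OF equiv_loc_frac_rel *] show "loc_frac A U b v = loc_frac A U a u"
    by (simp add: loc_frac_def)
qed

lemma loc_frac_self: "\<lbrakk>a \<in> carrier A; u \<in> U\<rbrakk> \<Longrightarrow> (a, u) \<in> loc_frac A U a u"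
  using U_one by (auto simp: loc_frac_def loc_frac_rel_iff)

lemma loc_frac_closed [simp, intro]:
  "\<lbrakk>a \<in> carrier A; u \<in> U\<rbrakk> \<Longrightarrow> loc_frac A U a u \<in> carrier (localization A U)"
  by (auto simp: localization_def loc_frac_def intro: quotientI)

lemma localization_carrierE:
  assumes "x \<in> carrier (localization A U)"
  obtains a u where "a \<in> carrier A" "u \<in> U" "x = loc_frac A U a u"
  using assms by (auto simp: localization_def loc_frac_def elim!: quotientE)

lemma localization_mult:
  assumes "a \<in> carrier A" "u \<in> U" "b \<in> carrier A" "v \<in> U"
  shows "loc_frac A U a u \<otimes>\<^bsub>localization A U\<^esub> loc_frac A U b v = loc_frac A U (a \<otimes> b) (u \<otimes> v)"
proof -
  have *: "loc_frac A U (a' \<otimes> b') (u' \<otimes> v') = loc_frac A U (a \<otimes> b) (u \<otimes> v)"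
    if "(a', u') \<in> loc_frac A U a u" "(b', v') \<in> loc_frac A U b v" for a' u' b' v'
  proof -
    note c = loc_frac_memD[OF that(1)] loc_frac_memD[OF that(2)]
    obtain w where w: "w \<in> U" "w \<otimes> (a' \<otimes> u) = w \<otimes> (a \<otimes> u')"
      using c(5) c by (auto simp: loc_frac_eq_iff)
    obtain w' where w': "w' \<in> U" "w' \<otimes> (b' \<otimes> v) = w' \<otimes> (b \<otimes> v')"
      using c(10) c by (auto simp: loc_frac_eq_iff)
    have car: "w \<in> carrier A" "w' \<in> carrier A" "u \<in> carrier A" "v \<in> carrier A"
      "u' \<in> carrier A" "v' \<in> carrier A"
      using w w' c by auto
    have "(w \<otimes> w') \<otimes> ((a' \<otimes> b') \<otimes> (u \<otimes> v)) = (w \<otimes> (a' \<otimes> u)) \<otimes> (w' \<otimes> (b' \<otimes> v))"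
      using car c by (simp add: m_ac)
    also have "\<dots> = (w \<otimes> w') \<otimes> ((a \<otimes> b) \<otimes> (u' \<otimes> v'))"
      unfolding w(2) w'(2) using car c by (simp add: m_ac)
    finally show ?thesis
      using c w w' by (subst loc_frac_eq_iff) (auto simp: U_mult)
  qed
  show ?thesis
  proof (intro equalityI subsetI)
    fix x assume "x \<in> loc_frac A U a u \<otimes>\<^bsub>localization A U\<^esub> loc_frac A U b v"
    then obtain a' u' b' v' where "(a', u') \<in> loc_frac A U a u" "(b', v') \<in> loc_frac A U b v"
      "x \<in> loc_frac A U (a' \<otimes> b') (u' \<otimes> v')"
      by (auto simp: localization_def)
    then show "x \<in> loc_frac A U (a \<otimes> b) (u \<otimes> v)"
      using * by blast
  next
    fix x assume "x \<in> loc_frac A U (a \<otimes> b) (u \<otimes> v)"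
    then show "x \<in> loc_frac A U a u \<otimes>\<^bsub>localization A U\<^esub> loc_frac A U b v"
      using loc_frac_self[OF assms(1,2)] loc_frac_self[OF assms(3,4)]
      unfolding localization_def by fastforce
  qed
qed

lemma localization_add:
  assumes "a \<in> carrier A" "u \<in> U" "b \<in> carrier A" "v \<in> U"
  shows "loc_frac A U a u \<oplus>\<^bsub>localization A U\<^esub> loc_frac A U b v =
    loc_frac A U (a \<otimes> v \<oplus> b \<otimes> u) (u \<otimes> v)"
proof -
  have *: "loc_frac A U (a' \<otimes> v' \<oplus> b' \<otimes> u') (u' \<otimes> v') = loc_frac A U (a \<otimes> v \<oplus> b \<otimes> u) (u \<otimes> v)"
    if "(a', u') \<in> loc_frac A U a u" "(b', v') \<in> loc_frac A U b v" for a' u' b' v'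
  proof -
    note c = loc_frac_memD[OF that(1)] loc_frac_memD[OF that(2)]
    obtain w where w: "w \<in> U" "w \<otimes> (a' \<otimes> u) = w \<otimes> (a \<otimes> u')"
      using c(5) c by (auto simp: loc_frac_eq_iff)
    obtain w' where w': "w' \<in> U" "w' \<otimes> (b' \<otimes> v) = w' \<otimes> (b \<otimes> v')"
      using c(10) c by (auto simp: loc_frac_eq_iff)
    have car: "w \<in> carrier A" "w' \<in> carrier A" "u \<in> carrier A" "v \<in> carrier A"
      "u' \<in> carrier A" "v' \<in> carrier A"
      using w w' c by auto
    have "(w \<otimes> w') \<otimes> ((a' \<otimes> v' \<oplus> b' \<otimes> u') \<otimes> (u \<otimes> v)) =
      (w' \<otimes> v' \<otimes> v) \<otimes> (w \<otimes> (a' \<otimes> u)) \<oplus> (w \<otimes> u' \<otimes> u) \<otimes> (w' \<otimes> (b' \<otimes> v))"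
      using car c by (simp add: m_ac l_distr r_distr)
    also have "\<dots> = (w \<otimes> w') \<otimes> ((a \<otimes> v \<oplus> b \<otimes> u) \<otimes> (u' \<otimes> v'))"
      unfolding w(2) w'(2) using car c by (simp add: m_ac l_distr r_distr)
    finally show ?thesis
      using c w w' by (subst loc_frac_eq_iff) (auto simp: U_mult)
  qed
  show ?thesis
  proof (intro equalityI subsetI)
    fix x assume "x \<in> loc_frac A U a u \<oplus>\<^bsub>localization A U\<^esub> loc_frac A U b v"
    then obtain a' u' b' v' where "(a', u') \<in> loc_frac A U a u" "(b', v') \<in> loc_frac A U b v"
      "x \<in> loc_frac A U (a' \<otimes> v' \<oplus> b' \<otimes> u') (u' \<otimes> v')"
      by (auto simp: localization_def)
    then show "x \<in> loc_frac A U (a \<otimes> v \<oplus> b \<otimes> u) (u \<otimes> v)"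
      using * by blast
  next
    fix x assume "x \<in> loc_frac A U (a \<otimes> v \<oplus> b \<otimes> u) (u \<otimes> v)"
    then show "x \<in> loc_frac A U a u \<oplus>\<^bsub>localization A U\<^esub> loc_frac A U b v"
      using loc_frac_self[OF assms(1,2)] loc_frac_self[OF assms(3,4)]
      unfolding localization_def by fastforce
  qed
qed

lemma localization_one: "\<one>\<^bsub>localization A U\<^esub> = loc_frac A U \<one> \<one>"
  and localization_zero: "\<zero>\<^bsub>localization A U\<^esub> = loc_frac A U \<zero> \<one>"
  by (simp_all add: localization_def)

lemma loc_frac_eqI: "\<lbrakk>a \<in> carrier A; u \<in> U; b \<in> carrier A; v \<in> U; a \<otimes> v = b \<otimes> u\<rbrakk>
   \<Longrightarrow> loc_frac A U a u = loc_frac A U b v"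
  using U_one by (auto simp: loc_frac_eq_iff)

lemma cring_localization: "cring (localization A U)"
proof (rule cringI)
  let ?L = "localization A U"
  note simps = localization_add localization_mult localization_one localization_zero
    U_mult U_one
  show "abelian_group ?L"
  proof (rule abelian_groupI)
    fix x y z assume "x \<in> carrier ?L" "y \<in> carrier ?L" "z \<in> carrier ?L"
    then obtain a u b v c w where *:
      "a \<in> carrier A" "u \<in> U" "x = loc_frac A U a u"
      "b \<in> carrier A" "v \<in> U" "y = loc_frac A U b v"
      "c \<in> carrier A" "w \<in> U" "z = loc_frac A U c w"
      by (metis localization_carrierE)
    then show "x \<oplus>\<^bsub>?L\<^esub> y \<in> carrier ?L"
      by (simp add: simps)
    show "x \<oplus>\<^bsub>?L\<^esub> y \<oplus>\<^bsub>?L\<^esub> z = x \<oplus>\<^bsub>?L\<^esub> (y \<oplus>\<^bsub>?L\<^esub> z)"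
      using * by (simp add: simps l_distr r_distr m_ac a_ac)
  next
    fix x y assume "x \<in> carrier ?L" "y \<in> carrier ?L"
    then obtain a u b v where *:
      "a \<in> carrier A" "u \<in> U" "x = loc_frac A U a u"
      "b \<in> carrier A" "v \<in> U" "y = loc_frac A U b v"
      by (metis localization_carrierE)
    then show "x \<oplus>\<^bsub>?L\<^esub> y = y \<oplus>\<^bsub>?L\<^esub> x"
      by (simp add: simps m_ac a_ac)
  next
    show "\<zero>\<^bsub>?L\<^esub> \<in> carrier ?L"
      by (simp add: simps)
  next
    fix x assume "x \<in> carrier ?L"
    then obtain a u where *: "a \<in> carrier A" "u \<in> U" "x = loc_frac A U a u"
      by (metis localization_carrierE)
    then show "\<zero>\<^bsub>?L\<^esub> \<oplus>\<^bsub>?L\<^esub> x = x"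
      by (simp add: simps)
    have "loc_frac A U (\<ominus> a) u \<oplus>\<^bsub>?L\<^esub> x = \<zero>\<^bsub>?L\<^esub>"
      using * by (simp add: simps) (rule loc_frac_eqI; simp add: U_mult U_one l_minus l_neg)
    moreover have "loc_frac A U (\<ominus> a) u \<in> carrier ?L"
      using * by simp
    ultimately show "\<exists>y\<in>carrier ?L. y \<oplus>\<^bsub>?L\<^esub> x = \<zero>\<^bsub>?L\<^esub>"
      by blast
  qed
  show "comm_monoid ?L"
  proof (rule comm_monoidI)
    fix x y z assume "x \<in> carrier ?L" "y \<in> carrier ?L" "z \<in> carrier ?L"
    then obtain a u b v c w where *:
      "a \<in> carrier A" "u \<in> U" "x = loc_frac A U a u"
      "b \<in> carrier A" "v \<in> U" "y = loc_frac A U b v"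
      "c \<in> carrier A" "w \<in> U" "z = loc_frac A U c w"
      by (metis localization_carrierE)
    then show "x \<otimes>\<^bsub>?L\<^esub> y \<in> carrier ?L"
      by (simp add: simps)
    show "x \<otimes>\<^bsub>?L\<^esub> y \<otimes>\<^bsub>?L\<^esub> z = x \<otimes>\<^bsub>?L\<^esub> (y \<otimes>\<^bsub>?L\<^esub> z)"
      using * by (simp add: simps m_ac)
  next
    fix x y assume "x \<in> carrier ?L" "y \<in> carrier ?L"
    then obtain a u b v where *:
      "a \<in> carrier A" "u \<in> U" "x = loc_frac A U a u"
      "b \<in> carrier A" "v \<in> U" "y = loc_frac A U b v"
      by (metis localization_carrierE)
    then show "x \<otimes>\<^bsub>?L\<^esub> y = y \<otimes>\<^bsub>?L\<^esub> x"
      by (simp add: simps m_ac)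
  next
    show "\<one>\<^bsub>?L\<^esub> \<in> carrier ?L"
      by (simp add: simps)
  next
    fix x assume "x \<in> carrier ?L"
    then obtain a u where *: "a \<in> carrier A" "u \<in> U" "x = loc_frac A U a u"
      by (metis localization_carrierE)
    then show "\<one>\<^bsub>?L\<^esub> \<otimes>\<^bsub>?L\<^esub> x = x"
      by (simp add: simps)
  qed
  fix x y z assume "x \<in> carrier ?L" "y \<in> carrier ?L" "z \<in> carrier ?L"
  then obtain a u b v c w where *:
    "a \<in> carrier A" "u \<in> U" "x = loc_frac A U a u"
    "b \<in> carrier A" "v \<in> U" "y = loc_frac A U b v"
    "c \<in> carrier A" "w \<in> U" "z = loc_frac A U c w"
    by (metis localization_carrierE)
  then show "(x \<oplus>\<^bsub>?L\<^esub> y) \<otimes>\<^bsub>?L\<^esub> z = x \<otimes>\<^bsub>?L\<^esub> z \<oplus>\<^bsub>?L\<^esub> y \<otimes>\<^bsub>?L\<^esub> z"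
    by (simp add: simps) (rule loc_frac_eqI; simp add: U_mult U_one l_distr r_distr m_ac a_ac)
qed

end

lemma (in primeideal) mult_subset_compl: "mult_subset R (carrier R - I)"
proof unfold_locales
  show "\<one> \<in> carrier R - I"
    using I_notcarr one_imp_carrier by blast
qed (use I_prime in auto)

lemma (in primeideal) cring_local_ring_at: "cring (local_ring_at R I)"
  unfolding local_ring_at_def by (rule mult_subset.cring_localization[OF mult_subset_compl])


section \<open>Cyclic modules, associated primes, symbolic powers\<close>

definition quot_module :: "('a, 'b) ring_scheme \<Rightarrow> 'a set \<Rightarrow> ('a, 'a set) module" where
  "quot_module A K = ring.extend (A Quot K)
     (module.fields (\<lambda>a C. (K +>\<^bsub>A\<^esub> a) \<otimes>\<^bsub>A Quot K\<^esub> C))"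

lemma quot_module_simps [simp]:
  "carrier (quot_module A K) = carrier (A Quot K)"
  "add (quot_module A K) = add (A Quot K)"
  "ring.zero (quot_module A K) = ring.zero (A Quot K)"
  "monoid.mult (quot_module A K) = monoid.mult (A Quot K)"
  "one (quot_module A K) = one (A Quot K)"
  "a \<odot>\<^bsub>quot_module A K\<^esub> C = (K +>\<^bsub>A\<^esub> a) \<otimes>\<^bsub>A Quot K\<^esub> C"
  by (simp_all add: quot_module_def ring.defs module.defs FactRing_def)

lemma module_quot_module:
  assumes "cring A" "ideal K A"
  shows "module A (quot_module A K)"
proof -
  interpret A: cring A by fact
  interpret K: ideal K A by fact
  interpret Q: cring "A Quot K" by (rule K.quotient_is_cring) fact
  interpret h: ring_hom_ring A "A Quot K" "(+>\<^bsub>A\<^esub>) K"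
    by (rule K.rcos_ring_hom_ring)
  have "abelian_group (quot_module A K)"
  proof (rule abelian_groupI)
    fix x assume "x \<in> carrier (quot_module A K)"
    then show "\<exists>y\<in>carrier (quot_module A K). y \<oplus>\<^bsub>quot_module A K\<^esub> x = \<zero>\<^bsub>quot_module A K\<^esub>"
      by (intro bexI[of _ "\<ominus>\<^bsub>A Quot K\<^esub> x"]) (simp_all add: Q.l_neg)
  qed (simp_all add: Q.a_ac)
  then show ?thesis
    using assms
    by (intro moduleI) (simp_all add: Q.l_distr Q.r_distr Q.m_assoc)
qed

definition Ass :: "('a, 'b) ring_scheme \<Rightarrow> ('a, 'c, 'd) module_scheme \<Rightarrow> 'a set set" where
  "Ass A M = {P. primeideal P A \<and>
     (\<exists>x\<in>carrier M. P = {a \<in> carrier A. a \<odot>\<^bsub>M\<^esub> x = \<zero>\<^bsub>M\<^esub>})}"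

definition ideal_power :: "('a, 'b) ring_scheme \<Rightarrow> 'a set \<Rightarrow> nat \<Rightarrow> 'a set" where
  "ideal_power A K s = K [^]\<^bsub>ideals_set A\<^esub> s"

definition symbolic_power :: "('a, 'b) ring_scheme \<Rightarrow> 'a set \<Rightarrow> nat \<Rightarrow> 'a set" where
  "symbolic_power A K s = {f \<in> carrier A. \<forall>P \<in> Ass A (quot_module A K).
     to_local A P f \<in> Idl\<^bsub>local_ring_at A P\<^esub> (to_local A P ` ideal_power A K s)}"


section \<open>Depth\<close>

text \<open>The submodule \<open>(C)M\<close>; it is the zero submodule for empty \<open>C\<close>.\<close>

definition smult_span ::
  "('a, 'b) ring_scheme \<Rightarrow> ('a, 'c, 'd) module_scheme \<Rightarrow> 'a set \<Rightarrow> 'c set" where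
  "smult_span A M C =
     \<Inter>{N. submodule N A M \<and> {a \<odot>\<^bsub>M\<^esub> x | a x. a \<in> C \<and> x \<in> carrier M} \<subseteq> N}"

definition regular_sequence ::
  "('a, 'b) ring_scheme \<Rightarrow> ('a, 'c, 'd) module_scheme \<Rightarrow> 'a list \<Rightarrow> bool" where
  "regular_sequence A M as \<longleftrightarrow>
     set as \<subseteq> carrier A \<and>
     (\<forall>i < length as. \<forall>x \<in> carrier M.
        (as ! i) \<odot>\<^bsub>M\<^esub> x \<in> smult_span A M (set (take i as)) \<longrightarrow>
        x \<in> smult_span A M (set (take i as))) \<and>
     smult_span A M (set as) \<noteq> carrier M"

text \<open>Depth of \<open>M\<close> with respect to the ideal \<open>Q\<close>. It is the usual notion if \<open>M\<close> is finitely
  generated over a noetherian ring and \<open>QM \<noteq> M\<close>; no convention for \<open>QM = M\<close> is intended.\<close>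

definition depth ::
  "('a, 'b) ring_scheme \<Rightarrow> 'a set \<Rightarrow> ('a, 'c, 'd) module_scheme \<Rightarrow> enat" where
  "depth A Q M = Sup {enat (length as) | as. regular_sequence A M as \<and> set as \<subseteq> Q}"


section \<open>Polynomial rings\<close>

type_synonym ('v, 'k) mpoly = "('v \<Rightarrow>\<^sub>0 nat) \<Rightarrow>\<^sub>0 'k"

abbreviation polynomial_ring :: "('v, 'k::comm_ring_1) mpoly ring" where
  "polynomial_ring \<equiv> ring_of_type_algebra"

definition variable :: "'v \<Rightarrow> ('v, 'k::comm_ring_1) mpoly" where
  "variable i = Poly_Mapping.single (Poly_Mapping.single i 1) 1"

definition graded_max_ideal :: "('v, 'k::comm_ring_1) mpoly set" where
  "graded_max_ideal = Idl\<^bsub>polynomial_ring\<^esub> (range variable)"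

definition exponent_degree :: "('v \<Rightarrow>\<^sub>0 nat) \<Rightarrow> nat" where
  "exponent_degree e = (\<Sum>i\<in>Poly_Mapping.keys e. Poly_Mapping.lookup e i)"

lift_definition homogeneous_component ::
  "nat \<Rightarrow> ('v, 'k::zero) mpoly \<Rightarrow> ('v, 'k) mpoly"
  is "\<lambda>d f e. if exponent_degree e = d then f e else 0"
  by (rule finite_subset) auto

definition homogeneous_ideal :: "('v, 'k::comm_ring_1) mpoly set \<Rightarrow> bool" where
  "homogeneous_ideal I \<longleftrightarrow>
     ideal I polynomial_ring \<and> (\<forall>f\<in>I. \<forall>d. homogeneous_component d f \<in> I)"

definition rename_exponent :: "('v \<Rightarrow> 'w) \<Rightarrow> ('v \<Rightarrow>\<^sub>0 nat) \<Rightarrow> ('w \<Rightarrow>\<^sub>0 nat)" where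
  "rename_exponent \<phi> e =
     (\<Sum>i\<in>Poly_Mapping.keys e. Poly_Mapping.single (\<phi> i) (Poly_Mapping.lookup e i))"

definition rename :: "('v \<Rightarrow> 'w) \<Rightarrow> ('v, 'k::comm_ring_1) mpoly \<Rightarrow> ('w, 'k) mpoly" where
  "rename \<phi> f = (\<Sum>e\<in>Poly_Mapping.keys f.
     Poly_Mapping.single (rename_exponent \<phi> e) (Poly_Mapping.lookup f e))"

text \<open>The tensor product of the polynomial rings in the variables \<open>'m\<close> and \<open>'n\<close> is realized as the
  polynomial ring in the variables \<open>'m + 'n\<close>, with structure maps \<open>rename Inl\<close> and
  \<open>rename Inr\<close>. The lemmas \<open>rename_single_mult\<close> and \<open>bij_sum_exponents\<close> below say that
  \<open>f \<otimes> g \<mapsto> rename Inl f * rename Inr g\<close> carries the monomial basis of the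
  tensor product bijectively to the monomial basis.\<close>

definition extend_left ::
  "('m, 'k::comm_ring_1) mpoly set \<Rightarrow> ('m + 'n, 'k) mpoly set" where
  "extend_left I = Idl\<^bsub>polynomial_ring\<^esub> (rename Inl ` I)"

definition extend_right ::
  "('n, 'k::comm_ring_1) mpoly set \<Rightarrow> ('m + 'n, 'k) mpoly set" where
  "extend_right J = Idl\<^bsub>polynomial_ring\<^esub> (rename Inr ` J)"

lemma rename_single: "rename \<phi> (Poly_Mapping.single e c) =
    Poly_Mapping.single (rename_exponent \<phi> e) c"
  by (cases "c = 0") (simp_all add: rename_def)

lemma rename_single_mult:
  "rename Inl (Poly_Mapping.single d a) * rename Inr (Poly_Mapping.single e b) =
   Poly_Mapping.single (rename_exponent Inl d + rename_exponent Inr e) (a * b)"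
  by (simp add: rename_single mult_single)

lemma lookup_rename_exponent:
  assumes "inj \<phi>"
  shows "Poly_Mapping.lookup (rename_exponent \<phi> e) (\<phi> i) = Poly_Mapping.lookup e i"
proof -
  have "Poly_Mapping.lookup (rename_exponent \<phi> e) (\<phi> i) =
    (\<Sum>j\<in>Poly_Mapping.keys e. if j = i then Poly_Mapping.lookup e j else 0)"
    using assms by (auto simp: rename_exponent_def lookup_sum lookup_single when_def inj_eq
        intro!: sum.cong)
  also have "\<dots> = Poly_Mapping.lookup e i"
    by (simp add: sum.delta in_keys_iff)
  finally show ?thesis .
qed

lemma lookup_rename_exponent_other:
  "j \<notin> range \<phi> \<Longrightarrow> Poly_Mapping.lookup (rename_exponent \<phi> e) j = 0"
  by (auto simp: rename_exponent_def lookup_sum lookup_single when_def intro!: sum.neutral)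

lemma bij_sum_exponents:
  "bij (\<lambda>(d :: 'm \<Rightarrow>\<^sub>0 nat, e :: 'n \<Rightarrow>\<^sub>0 nat). rename_exponent Inl d + rename_exponent Inr e)"
    (is "bij ?h")
proof (rule bijI)
  have L: "Poly_Mapping.lookup (?h (d, e)) (Inl i) = Poly_Mapping.lookup d i"
    and R: "Poly_Mapping.lookup (?h (d, e)) (Inr j) = Poly_Mapping.lookup e j"
    for d :: "'m \<Rightarrow>\<^sub>0 nat" and e :: "'n \<Rightarrow>\<^sub>0 nat" and i j
    by (simp_all add: lookup_add lookup_rename_exponent)
       (auto intro!: lookup_rename_exponent_other)
  show "inj ?h"
  proof (rule injI, clarify)
    fix d d' :: "'m \<Rightarrow>\<^sub>0 nat" and e e' :: "'n \<Rightarrow>\<^sub>0 nat"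
    assume "rename_exponent Inl d + rename_exponent Inr e =
      rename_exponent Inl d' + rename_exponent Inr e'"
    then have "?h (d, e) = ?h (d', e')" by simp
    then show "d = d' \<and> e = e'"
      by (metis L R poly_mapping_eqI)
  qed
  show "surj ?h"
  proof (rule surjI)
    fix c :: "('m + 'n) \<Rightarrow>\<^sub>0 nat"
    have "Poly_Mapping.lookup (?h (Poly_Mapping.map_key Inl c, Poly_Mapping.map_key Inr c)) k =
      Poly_Mapping.lookup c k" for k
      by (cases k) (simp_all only: L R, simp_all add: map_key.rep_eq)
    then show "?h (Poly_Mapping.map_key Inl c, Poly_Mapping.map_key Inr c) = c"
      by (rule poly_mapping_eqI)
  qed
qed

end

theory Submission
  imports Defs
begin

text \<open>Let \<open>A = I + \<nn>\<close> and \<open>B = J + \<mm>\<close>. Setting the variables of one factor to zero defines ring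
  homomorphisms from \<open>T\<close> to \<open>R\<close> and \<open>S\<close>; the ideals \<open>A\<close> and \<open>B\<close> are the preimages of \<open>I\<close> and
  \<open>J\<close>, and \<open>F = A \<inter> B\<close>. If \<open>R/I\<close> and \<open>S/J\<close> have positive depth, no associated prime of \<open>A\<close>
  contains \<open>B\<close> and no associated prime of \<open>B\<close> contains \<open>A\<close>, hence the associated primes of \<open>F\<close> are
  those of \<open>A\<close> and of \<open>B\<close>, and at each of them \<open>F\<close> agrees locally with the ideal it comes from. If
  one depth vanishes, say that of \<open>R/I\<close>, noetherianity and prime avoidance give \<open>f \<notin> I\<close> with
  \<open>\<mm> f \<subseteq> I\<close>; since \<open>I \<subseteq> \<mm>\<^sup>2\<close>, it lies in \<open>\<mm>\<close> and is annihilated modulo \<open>F\<close> by exactly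
  the graded maximal ideal of \<open>T\<close>. That ideal is therefore associated to \<open>F\<close>, and localizing there
  does not enlarge the homogeneous ideal \<open>F\<^sup>s\<close>.\<close>

section \<open>Ideals and symbolic powers in commutative rings\<close>

lemma ring_of_type_algebra_simps [simp]:
  "carrier ring_of_type_algebra = UNIV"
  "x \<otimes>\<^bsub>ring_of_type_algebra\<^esub> y = x * y"
  "x \<oplus>\<^bsub>ring_of_type_algebra\<^esub> y = x + y"
  "\<zero>\<^bsub>ring_of_type_algebra\<^esub> = 0"
  "\<one>\<^bsub>ring_of_type_algebra\<^esub> = 1"
  by (simp_all add: ring_of_type_algebra_def)

text \<open>Negation needs no clause of its own, since -a = (-1) * a. This form reduces later ideal
  proofs to elementary closure checks.\<close>

lemma ideal_type_iff:
  fixes K :: "'a::comm_ring_1 set"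
  shows "ideal K ring_of_type_algebra \<longleftrightarrow>
    0 \<in> K \<and> (\<forall>a\<in>K. \<forall>b\<in>K. a + b \<in> K) \<and> (\<forall>a\<in>K. \<forall>x. x * a \<in> K)" (is "_ \<longleftrightarrow> ?R")
proof
  assume "ideal K ring_of_type_algebra"
  then interpret ideal K "ring_of_type_algebra :: 'a ring" .
  show ?R
    using additive_subgroup.zero_closed[OF is_additive_subgroup]
      additive_subgroup.a_closed[OF is_additive_subgroup] I_l_closed by simp
next
  assume R: ?R
  interpret ring "ring_of_type_algebra :: 'a ring" by (rule ring_from_type_algebra)
  have neg: "- a \<in> K" if "a \<in> K" for a
  proof -
    have "(- 1) * a \<in> K" using R that by blast
    then show ?thesis by simp
  qed
  have inv: "\<ominus>\<^bsub>ring_of_type_algebra\<^esub> a = - a" for a :: 'a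
    using minus_equality[of "- a" a] by simp
  show "ideal K ring_of_type_algebra"
  proof (rule idealI)
    show "ring (ring_of_type_algebra :: 'a ring)" by (rule ring_from_type_algebra)
    show "subgroup K (add_monoid ring_of_type_algebra)"
      by (rule add.subgroupI) (use R neg inv in auto)
  qed (use R in \<open>auto simp: mult.commute\<close>)
qed

lemma ideal_typeD:
  fixes K :: "'a::comm_ring_1 set"
  assumes "ideal K ring_of_type_algebra"
  shows "0 \<in> K" "\<And>a b. a \<in> K \<Longrightarrow> b \<in> K \<Longrightarrow> a + b \<in> K"
    "\<And>a x. a \<in> K \<Longrightarrow> x * a \<in> K" "\<And>a x. a \<in> K \<Longrightarrow> a * x \<in> K"
    "\<And>a. a \<in> K \<Longrightarrow> - a \<in> K"
    "\<And>a b. a \<in> K \<Longrightarrow> b \<in> K \<Longrightarrow> a - b \<in> K"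
    "\<And>g A. (\<And>i. i \<in> A \<Longrightarrow> g i \<in> K) \<Longrightarrow> sum g A \<in> K"
proof -
  note R = assms[unfolded ideal_type_iff]
  show "0 \<in> K" and add: "\<And>a b. a \<in> K \<Longrightarrow> b \<in> K \<Longrightarrow> a + b \<in> K"
    and "\<And>a x. a \<in> K \<Longrightarrow> x * a \<in> K" "\<And>a x. a \<in> K \<Longrightarrow> a * x \<in> K"
    using R by (auto simp: mult.commute)
  show neg: "- a \<in> K" if "a \<in> K" for a
  proof -
    have "(- 1) * a \<in> K" using R that by blast
    then show ?thesis by simp
  qed
  show "a - b \<in> K" if "a \<in> K" "b \<in> K" for a b
    using add[OF that(1) neg[OF that(2)]] by simp
  show "sum g A \<in> K" if "\<And>i. i \<in> A \<Longrightarrow> g i \<in> K" for g A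
    using that by (induction A rule: infinite_finite_induct) (auto simp: \<open>0 \<in> K\<close> add)
qed

lemma primeideal_type_iff:
  fixes P :: "'a::comm_ring_1 set"
  shows "primeideal P ring_of_type_algebra \<longleftrightarrow>
    ideal P ring_of_type_algebra \<and> 1 \<notin> P \<and> (\<forall>a b. a * b \<in> P \<longrightarrow> a \<in> P \<or> b \<in> P)" (is "_ \<longleftrightarrow> ?R")
proof
  assume "primeideal P ring_of_type_algebra"
  then interpret primeideal P "ring_of_type_algebra :: 'a ring" .
  show ?R
    using is_ideal I_notcarr one_imp_carrier I_prime by auto
next
  assume ?R
  then show "primeideal P ring_of_type_algebra"
    by (intro primeidealI) (auto intro: cring_from_type_algebra)
qed

lemma genideal_type_ideal: "ideal (Idl\<^bsub>ring_of_type_algebra\<^esub> S) (ring_of_type_algebra :: 'a::comm_ring_1 ring)"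
  by (rule ring.genideal_ideal[OF ring_from_type_algebra]) simp

lemma genideal_type_self: "S \<subseteq> Idl\<^bsub>(ring_of_type_algebra :: 'a::comm_ring_1 ring)\<^esub> S"
  by (rule ring.genideal_self[OF ring_from_type_algebra]) simp

lemma genideal_type_minimal:
  "\<lbrakk>ideal K (ring_of_type_algebra :: 'a::comm_ring_1 ring); S \<subseteq> K\<rbrakk> \<Longrightarrow> Idl\<^bsub>ring_of_type_algebra\<^esub> S \<subseteq> K"
  by (rule ring.genideal_minimal[OF ring_from_type_algebra])

lemma ideal_prod_type_ideal:
  "\<lbrakk>ideal K ring_of_type_algebra; ideal L ring_of_type_algebra\<rbrakk>
    \<Longrightarrow> ideal (K \<cdot>\<^bsub>ring_of_type_algebra\<^esub> L) (ring_of_type_algebra :: 'a::comm_ring_1 ring)"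
  by (rule ring.ideal_prod_is_ideal[OF ring_from_type_algebra])

text \<open>The ideal product is generated inductively from the products a * b by addition, and an
  ideal absorbs sums; so inclusions need testing on generators only.\<close>

lemma ideal_prod_type_subset_iff:
  fixes L :: "'a::comm_ring_1 set"
  assumes "ideal L ring_of_type_algebra"
  shows "A \<cdot>\<^bsub>ring_of_type_algebra\<^esub> B \<subseteq> L \<longleftrightarrow> (\<forall>a\<in>A. \<forall>b\<in>B. a * b \<in> L)"
proof
  assume *: "\<forall>a\<in>A. \<forall>b\<in>B. a * b \<in> L"
  show "A \<cdot>\<^bsub>ring_of_type_algebra\<^esub> B \<subseteq> L"
  proof
    fix x assume "x \<in> A \<cdot>\<^bsub>ring_of_type_algebra\<^esub> B"
    then show "x \<in> L"
      by (induction rule: ideal_prod.induct) (use * ideal_typeD(2)[OF assms] in auto)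
  qed
qed (use ideal_prod.prod[of _ A _ B "ring_of_type_algebra :: 'a ring"] in auto)

lemma set_add_type_iff:
  "x \<in> A <+>\<^bsub>ring_of_type_algebra\<^esub> B \<longleftrightarrow> (\<exists>a\<in>A. \<exists>b\<in>B. x = a + (b::'a::comm_ring_1))"
  by (auto simp: set_add_def')

lemma set_add_type_subset:
  assumes "ideal L (ring_of_type_algebra :: 'a::comm_ring_1 ring)" "A \<subseteq> L" "B \<subseteq> L"
  shows "A <+>\<^bsub>ring_of_type_algebra\<^esub> B \<subseteq> L"
  using assms(2,3) ideal_typeD(2)[OF assms(1)] by (auto simp: set_add_type_iff subset_iff)

text \<open>The unit of the monoid of ideals is the whole ring, which is therefore the zeroth power;
  the recursion multiplies on the right.\<close>

lemma ideal_power_0 [simp]: "ideal_power A K 0 = carrier A"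
  and ideal_power_Suc [simp]: "ideal_power A K (Suc s) = ideal_power A K s \<cdot>\<^bsub>A\<^esub> K"
  by (simp_all add: ideal_power_def ideals_set_def nat_pow_def)

lemma ideal_power_type_ideal:
  "ideal K (ring_of_type_algebra :: 'a::comm_ring_1 ring) \<Longrightarrow> ideal (ideal_power ring_of_type_algebra K s) ring_of_type_algebra"
proof (induction s)
  case 0
  then show ?case by (simp add: ideal_type_iff)
qed (simp add: ideal_prod_type_ideal)

lemma ideal_power_mono:
  assumes "ideal K (ring_of_type_algebra :: 'a::comm_ring_1 ring)" "K \<subseteq> L" "ideal L ring_of_type_algebra"
  shows "ideal_power ring_of_type_algebra K s \<subseteq> ideal_power ring_of_type_algebra L s"
proof (induction s)
  case (Suc s)
  then show ?case
    using assms(2) ideal_power_type_ideal[OF assms(3), of "Suc s"]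
      ideal_prod.prod[of _ "ideal_power ring_of_type_algebra L s" _ L "ring_of_type_algebra :: 'a ring"]
    by (auto simp: ideal_prod_type_subset_iff)
qed simp

text \<open>The inductive step regroups x^(s+1) * (a * b) as (x^s * a) * (x * b). Elements sent into
  \<open>L\<close>^(s+1) by x^(s+1) form an ideal, so products a * b suffice.\<close>

lemma power_mult_ideal_power:
  fixes x :: "'a::comm_ring_1"
  assumes "ideal K ring_of_type_algebra" "ideal L ring_of_type_algebra" "\<And>a. a \<in> K \<Longrightarrow> x * a \<in> L"
    and "a \<in> ideal_power ring_of_type_algebra K s"
  shows "x ^ s * a \<in> ideal_power ring_of_type_algebra L s"
  using assms(4)
proof (induction s arbitrary: a)
  case (Suc s)
  have id: "ideal {a. x ^ Suc s * a \<in> ideal_power ring_of_type_algebra L (Suc s)} ring_of_type_algebra"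
    using ideal_typeD[OF ideal_power_type_ideal[OF assms(2), of "Suc s"]]
    by (simp add: ideal_type_iff distrib_left mult.left_commute)
  have "ideal_power ring_of_type_algebra K (Suc s) \<subseteq> {a. x ^ Suc s * a \<in> ideal_power ring_of_type_algebra L (Suc s)}"
    unfolding ideal_power_Suc[of _ K] ideal_prod_type_subset_iff[OF id]
  proof (intro ballI CollectI)
    fix a b assume "a \<in> ideal_power ring_of_type_algebra K s" "b \<in> K"
    then have "(x ^ s * a) * (x * b) \<in> ideal_power ring_of_type_algebra L (Suc s)"
      using ideal_prod.prod[of "x ^ s * a" _ "x * b" L "ring_of_type_algebra :: 'a ring"] Suc.IH assms(3) by simp
    then show "x ^ Suc s * (a * b) \<in> ideal_power ring_of_type_algebra L (Suc s)"
      by (simp only: power_Suc mult_ac)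
  qed
  then show ?case using Suc.prems by blast
qed simp

section \<open>Associated primes, localization and symbolic powers in terms of ring elements\<close>

lemma Ass_quot_module_type:
  fixes K :: "'a::comm_ring_1 set"
  assumes K: "ideal K ring_of_type_algebra"
  shows "Ass ring_of_type_algebra (quot_module ring_of_type_algebra K) =
    {P. primeideal P ring_of_type_algebra \<and> (\<exists>f. P = {a. a * f \<in> K})}"
proof -
  interpret K: ideal K "ring_of_type_algebra :: 'a ring" by fact
  \<comment> \<open>The annihilator of the coset of \<open>f\<close> is the colon ideal K :
    f.\<close>
  have [simp]: "(K +>\<^bsub>ring_of_type_algebra\<^esub> a) \<otimes>\<^bsub>ring_of_type_algebra Quot K\<^esub>
      (K +>\<^bsub>ring_of_type_algebra\<^esub> f) = \<zero>\<^bsub>ring_of_type_algebra Quot K\<^esub> \<longleftrightarrow> a * f \<in> K" for a f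
  proof -
    have "(K +>\<^bsub>ring_of_type_algebra\<^esub> a) \<otimes>\<^bsub>ring_of_type_algebra Quot K\<^esub>
        (K +>\<^bsub>ring_of_type_algebra\<^esub> f) = K +>\<^bsub>ring_of_type_algebra\<^esub> (a * f)"
      using K.rcoset_mult_add[of a f] by (simp add: FactRing_def)
    moreover have "\<zero>\<^bsub>ring_of_type_algebra Quot K\<^esub> = K" by (simp add: FactRing_def)
    moreover have "K +>\<^bsub>ring_of_type_algebra\<^esub> (a * f) = K \<longleftrightarrow> a * f \<in> K"
      using K.rcos_const_imp_mem[of "a * f"] K.a_rcos_const[of "a * f"] by auto
    ultimately show ?thesis by simp
  qed
  have car: "carrier (ring_of_type_algebra Quot K) = range (\<lambda>f. K +>\<^bsub>ring_of_type_algebra\<^esub> f)"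
    by (auto simp: FactRing_def A_RCOSETS_def')
  show ?thesis
    by (auto simp: Ass_def car)
qed

text \<open>The extension of \<open>K\<close> consists of the fractions k/u with k in
  \<open>K\<close> and u outside \<open>P\<close>. An equation f/1 = k/u means w * f * u = w * k for
  some w outside \<open>P\<close>, so the multiplier w * u brings \<open>f\<close> into
  \<open>K\<close>.\<close>

lemma to_local_mem_genideal_iff:
  fixes K :: "'a::comm_ring_1 set"
  assumes P: "primeideal P ring_of_type_algebra" and K: "ideal K ring_of_type_algebra"
  shows "to_local ring_of_type_algebra P f
      \<in> Idl\<^bsub>local_ring_at ring_of_type_algebra P\<^esub> (to_local ring_of_type_algebra P ` K) \<longleftrightarrow>
    (\<exists>u. u \<notin> P \<and> u * f \<in> K)"
proof -
  interpret P: primeideal P "ring_of_type_algebra :: 'a ring" by fact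
  define U where "U = carrier ring_of_type_algebra - P"
  interpret M: mult_subset "ring_of_type_algebra :: 'a ring" U
    unfolding U_def by (rule P.mult_subset_compl)
  let ?R = "ring_of_type_algebra :: 'a ring" and ?L = "localization (ring_of_type_algebra :: 'a ring) U"
  let ?l = "loc_frac ?R U"
  interpret L: cring ?L by (rule M.cring_localization)
  note D = ideal_typeD[OF K]
  have U1: "1 \<in> U" using M.U_one by simp
  have Um: "u * v \<in> U" if "u \<in> U" "v \<in> U" for u v using M.U_mult[OF that] by simp
  have cl: "?l a u \<in> carrier ?L" if "u \<in> U" for a u using that by simp
  have eq: "?l a u = ?l b v \<longleftrightarrow> (\<exists>w\<in>U. w * (a * v) = w * (b * u))" if "u \<in> U" "v \<in> U" for a u b v
    using M.loc_frac_eq_iff[of a u b v] that by simp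
  have E: "\<exists>a u. u \<in> U \<and> x = ?l a u" if "x \<in> carrier ?L" for x
    using M.localization_carrierE[OF that] by (metis UNIV_I)
  note simps = M.localization_mult[simplified] M.localization_add[simplified]
    M.localization_one[simplified] M.localization_zero[simplified]
  \<comment> \<open>The expected description of the extended ideal; common denominators make it
    closed under addition.\<close>
  define N where "N = {?l k u | k u. k \<in> K \<and> u \<in> U}"
  have N: "ideal N ?L"
  proof (rule idealI)
    show "ring ?L" by (rule L.ring_axioms)
    have mul: "x \<otimes>\<^bsub>?L\<^esub> y \<in> N" if y: "y \<in> N" and x: "x \<in> carrier ?L" for x y
    proof -
      obtain k u where 1: "y = ?l k u" "k \<in> K" "u \<in> U" using y by (auto simp: N_def)
      obtain a v where 2: "x = ?l a v" "v \<in> U" using E[OF x] by blast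
      have "x \<otimes>\<^bsub>?L\<^esub> y = ?l (a * k) (v * u)" using 1 2 by (simp add: simps)
      then show ?thesis using 1 2 D(3) Um unfolding N_def by blast
    qed
    show "x \<otimes>\<^bsub>?L\<^esub> y \<in> N" if "y \<in> N" "x \<in> carrier ?L" for x y by (rule mul[OF that])
    show "y \<otimes>\<^bsub>?L\<^esub> x \<in> N" if "y \<in> N" "x \<in> carrier ?L" for x y
    proof -
      have "y \<in> carrier ?L" using that(1) cl by (auto simp: N_def)
      then show ?thesis using mul[OF that] L.m_comm[OF _ that(2), of y] by simp
    qed
    have Nc: "N \<subseteq> carrier ?L" using cl by (auto simp: N_def)
    show "subgroup N (add_monoid ?L)"
    proof (rule L.add.subgroupI)
      show "N \<subseteq> carrier ?L" by (rule Nc)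
      show "N \<noteq> {}" using D(1) U1 by (auto simp: N_def)
      show "\<ominus>\<^bsub>?L\<^esub> x \<in> N" if "x \<in> N" for x
      proof -
        have "(\<ominus>\<^bsub>?L\<^esub> \<one>\<^bsub>?L\<^esub>) \<otimes>\<^bsub>?L\<^esub> x \<in> N" by (rule mul[OF that]) simp
        then show ?thesis using that Nc by (simp add: L.l_minus subset_iff)
      qed
      show "x \<oplus>\<^bsub>?L\<^esub> y \<in> N" if xy: "x \<in> N" "y \<in> N" for x y
      proof -
        obtain k u where 1: "x = ?l k u" "k \<in> K" "u \<in> U" using xy by (auto simp: N_def)
        obtain a v where 2: "y = ?l a v" "a \<in> K" "v \<in> U" using xy by (auto simp: N_def)
        have "x \<oplus>\<^bsub>?L\<^esub> y = ?l (k * v + a * u) (u * v)" using 1 2 by (simp add: simps)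
        then show ?thesis using 1 2 D(2,4) Um unfolding N_def by blast
      qed
    qed
  qed
  have "Idl\<^bsub>?L\<^esub> ((\<lambda>f. ?l f 1) ` K) = N"
  proof
    show "Idl\<^bsub>?L\<^esub> ((\<lambda>f. ?l f 1) ` K) \<subseteq> N"
      by (rule L.genideal_minimal[OF N]) (use U1 in \<open>auto simp: N_def\<close>)
    show "N \<subseteq> Idl\<^bsub>?L\<^esub> ((\<lambda>f. ?l f 1) ` K)"
    proof
      fix x assume "x \<in> N"
      then obtain k u where 1: "x = ?l k u" "k \<in> K" "u \<in> U" by (auto simp: N_def)
      have "(\<lambda>f. ?l f 1) ` K \<subseteq> carrier ?L" using U1 by auto
      note I = L.genideal_ideal[OF this] L.genideal_self[OF this]
      \<comment> \<open>The factorization k/u = (1/u) * (k/1) puts every element of \<open>N\<close>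
        into the generated ideal.\<close>
      have "?l 1 u \<otimes>\<^bsub>?L\<^esub> ?l k 1 \<in> Idl\<^bsub>?L\<^esub> ((\<lambda>f. ?l f 1) ` K)"
        by (rule ideal.I_l_closed[OF I(1)]) (use 1 I(2) in auto)
      then show "x \<in> Idl\<^bsub>?L\<^esub> ((\<lambda>f. ?l f 1) ` K)" using 1 U1 by (simp add: simps)
    qed
  qed
  moreover have "?l f 1 \<in> N \<longleftrightarrow> (\<exists>u\<in>U. u * f \<in> K)"
  proof
    assume "?l f 1 \<in> N"
    then obtain k u where 1: "?l f 1 = ?l k u" "k \<in> K" "u \<in> U" by (auto simp: N_def)
    then obtain w where "w \<in> U" "w * (f * u) = w * (k * 1)" using eq U1 by blast
    moreover have "w * (k * 1) \<in> K" using 1 D by simp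
    ultimately show "\<exists>u\<in>U. u * f \<in> K"
      using Um 1 by (metis mult.assoc mult.commute)
  next
    assume "\<exists>u\<in>U. u * f \<in> K"
    then obtain u where u: "u \<in> U" "u * f \<in> K" by blast
    \<comment> \<open>Expanding the fraction by \<open>u\<close> exhibits a numerator in
      \<open>K\<close>.\<close>
    have "?l f 1 = ?l (u * f) u" using eq u U1 by (auto simp: mult.commute)
    then show "?l f 1 \<in> N" using u unfolding N_def by blast
  qed
  ultimately show ?thesis
    by (auto simp: to_local_def[abs_def] local_ring_at_def U_def)
qed

text \<open>Clearing denominators replaces each localized condition by a multiplier outside the
  prime, so the arguments below work with multipliers instead of fractions.\<close>

lemma symbolic_power_type:
  fixes K :: "'a::comm_ring_1 set"
  assumes K: "ideal K ring_of_type_algebra"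
  shows "symbolic_power ring_of_type_algebra K s =
    {f. \<forall>P\<in>Ass ring_of_type_algebra (quot_module ring_of_type_algebra K).
       \<exists>u. u \<notin> P \<and> u * f \<in> ideal_power ring_of_type_algebra K s}"
  using to_local_mem_genideal_iff[OF _ ideal_power_type_ideal[OF K]]
  by (auto simp: symbolic_power_def Ass_def)

lemma ideal_power_subset_symbolic_power:
  fixes K :: "'a::comm_ring_1 set"
  assumes K: "ideal K ring_of_type_algebra"
  shows "ideal_power ring_of_type_algebra K s \<subseteq> symbolic_power ring_of_type_algebra K s"
  unfolding symbolic_power_type[OF K]
proof (intro subsetI CollectI ballI)
  fix f P assume "f \<in> ideal_power ring_of_type_algebra K s"
    and "P \<in> Ass ring_of_type_algebra (quot_module ring_of_type_algebra K)"
  then show "\<exists>u. u \<notin> P \<and> u * f \<in> ideal_power ring_of_type_algebra K s"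
    by (intro exI[of _ 1]) (auto simp: Ass_def primeideal_type_iff)
qed

text \<open>Multiplying by an element of \<open>B\<close> outside \<open>P\<close> moves \<open>A\<close> into \<open>A \<inter> B\<close>, so the two ideals agree
  locally at the associated primes of \<open>A\<close>.\<close>

lemma symbolic_power_Int:
  fixes A B :: "'a::comm_ring_1 set"
  assumes A: "ideal A ring_of_type_algebra" and B: "ideal B ring_of_type_algebra"
    and AB: "\<And>P. P \<in> Ass ring_of_type_algebra (quot_module ring_of_type_algebra A) \<Longrightarrow> \<not> B \<subseteq> P"
    and BA: "\<And>P. P \<in> Ass ring_of_type_algebra (quot_module ring_of_type_algebra B) \<Longrightarrow> \<not> A \<subseteq> P"
  shows "symbolic_power ring_of_type_algebra (A \<inter> B) s =
    symbolic_power ring_of_type_algebra A s \<inter> symbolic_power ring_of_type_algebra B s"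
proof -
  have F: "ideal (A \<inter> B) ring_of_type_algebra"
    using A B by (simp add: ideal_type_iff)
  \<comment> \<open>Stated for arbitrary ideals so that it can be used a second time with the roles
    of \<open>A\<close> and \<open>B\<close> exchanged.\<close>
  have *: "P \<in> Ass ring_of_type_algebra (quot_module ring_of_type_algebra (A \<inter> B)) \<and>
     (\<forall>f. (\<exists>u. u \<notin> P \<and> u * f \<in> ideal_power ring_of_type_algebra (A \<inter> B) s) \<longleftrightarrow>
       (\<exists>u. u \<notin> P \<and> u * f \<in> ideal_power ring_of_type_algebra A s))"
    if A: "ideal A ring_of_type_algebra" and B: "ideal B ring_of_type_algebra"
      and P: "P \<in> Ass ring_of_type_algebra (quot_module ring_of_type_algebra A)"
      and BP: "\<not> B \<subseteq> P" for P A B :: "'a set"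
  proof
    from P obtain f where pr: "primeideal P ring_of_type_algebra" and f: "P = {a. a * f \<in> A}"
      by (auto simp: Ass_quot_module_type[OF A])
    have F: "ideal (A \<inter> B) ring_of_type_algebra"
      using A B by (simp add: ideal_type_iff)
    from BP obtain x where x: "x \<in> B" "x \<notin> P" by blast
    have mul: "a * b \<notin> P" if "a \<notin> P" "b \<notin> P" for a b
      using that pr by (auto simp: primeideal_type_iff)
    \<comment> \<open>Modulo the intersection, \<open>x * f\<close> has annihilator
      \<open>P\<close>: the multiple x * (a * f) is always in \<open>B\<close>, and it is in
      \<open>A\<close> iff x * a is in \<open>P\<close>, that is, iff a is.\<close>
    have "a * (x * f) \<in> A \<inter> B \<longleftrightarrow> a \<in> P" for a
    proof -
      have [simp]: "a * (x * f) = x * (a * f)" by (simp add: mult_ac)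
      have "x * (a * f) \<in> B"
        using ideal_typeD(4)[OF B] x by simp
      moreover have "x * (a * f) \<in> A \<longleftrightarrow> x * a \<in> P" by (simp add: f mult.assoc)
      moreover have "x * a \<in> P \<longleftrightarrow> a \<in> P"
        using pr x ideal_typeD(3)[of P a x] by (auto simp: primeideal_type_iff)
      ultimately show ?thesis by simp
    qed
    then show "P \<in> Ass ring_of_type_algebra (quot_module ring_of_type_algebra (A \<inter> B))"
      using pr by (auto simp: Ass_quot_module_type[OF F])
    \<comment> \<open>As \<open>x\<close> sends \<open>A\<close> into the intersection, x^s sends
      \<open>A\<close>^s into the s-th power of the intersection; primality keeps this multiplier
      outside \<open>P\<close>.\<close>
    have xs: "x ^ s \<notin> P"
      by (induction s) (use pr mul x in \<open>auto simp: primeideal_type_iff\<close>)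
    show "\<forall>f. (\<exists>u. u \<notin> P \<and> u * f \<in> ideal_power ring_of_type_algebra (A \<inter> B) s) \<longleftrightarrow>
       (\<exists>u. u \<notin> P \<and> u * f \<in> ideal_power ring_of_type_algebra A s)"
    proof (intro allI iffI)
      fix g assume "\<exists>u. u \<notin> P \<and> u * g \<in> ideal_power ring_of_type_algebra (A \<inter> B) s"
      then show "\<exists>u. u \<notin> P \<and> u * g \<in> ideal_power ring_of_type_algebra A s"
        using ideal_power_mono[OF F Int_lower1 A] by blast
    next
      fix g assume "\<exists>u. u \<notin> P \<and> u * g \<in> ideal_power ring_of_type_algebra A s"
      then obtain u where u: "u \<notin> P" "u * g \<in> ideal_power ring_of_type_algebra A s" by blast
      have "x ^ s * (u * g) \<in> ideal_power ring_of_type_algebra (A \<inter> B) s"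
        by (rule power_mult_ideal_power[OF A F _ u(2)])
          (use ideal_typeD(3)[OF A] ideal_typeD(4)[OF B] x in auto)
      then show "\<exists>u. u \<notin> P \<and> u * g \<in> ideal_power ring_of_type_algebra (A \<inter> B) s"
        using mul[OF xs u(1)] by (metis mult.assoc)
    qed
  qed
  \<comment> \<open>For the converse, (A \<inter> B) : f is the intersection of A : f and B : f, and
    a prime that is an intersection of two ideals equals one of them.\<close>
  have **: "P \<in> Ass ring_of_type_algebra (quot_module ring_of_type_algebra A) \<union>
      Ass ring_of_type_algebra (quot_module ring_of_type_algebra B)"
    if P: "P \<in> Ass ring_of_type_algebra (quot_module ring_of_type_algebra (A \<inter> B))" for P
  proof -
    from P obtain f where pr: "primeideal P ring_of_type_algebra" and f: "P = {a. a * f \<in> A \<inter> B}"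
      by (auto simp: Ass_quot_module_type[OF F])
    have "P = {a. a * f \<in> A} \<or> P = {a. a * f \<in> B}"
    proof (rule ccontr)
      assume "\<not> ?thesis"
      then obtain a b where ab: "a * f \<in> A" "a \<notin> P" "b * f \<in> B" "b \<notin> P" using f by auto
      have "b * (a * f) \<in> A" "a * (b * f) \<in> B"
        using ab ideal_typeD(3)[OF A] ideal_typeD(3)[OF B] by blast+
      then have "a * b \<in> P" by (simp add: f mult_ac)
      then show False using ab pr by (auto simp: primeideal_type_iff)
    qed
    then show ?thesis
      using pr by (auto simp: Ass_quot_module_type[OF A] Ass_quot_module_type[OF B])
  qed
  note 1 = *[OF A B _ AB] and 2 = *[OF B A _ BA, unfolded Int_commute[of B A]]
  have "Ass ring_of_type_algebra (quot_module ring_of_type_algebra (A \<inter> B)) =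
      Ass ring_of_type_algebra (quot_module ring_of_type_algebra A) \<union>
      Ass ring_of_type_algebra (quot_module ring_of_type_algebra B)"
    using 1[THEN conjunct1] 2[THEN conjunct1] ** by (intro equalityI subsetI) (assumption | (erule UnE; assumption))+
  then show ?thesis
    unfolding symbolic_power_type[OF F] symbolic_power_type[OF A] symbolic_power_type[OF B]
    by (simp add: ball_Un Collect_conj_eq 1[THEN conjunct2, rule_format] 2[THEN conjunct2, rule_format]
        cong: ball_cong)
qed

section \<open>Depth and zero divisors\<close>

text \<open>No entries precede the first entry of a regular sequence, so its condition refers to the
  zero submodule.\<close>

lemma (in module) smult_span_empty: "smult_span R M {} = {\<zero>\<^bsub>M\<^esub>}"
proof
  have "submodule {\<zero>\<^bsub>M\<^esub>} R M"
    by (rule submoduleI) auto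
  then show "smult_span R M {} \<subseteq> {\<zero>\<^bsub>M\<^esub>}"
    unfolding smult_span_def by (intro Inter_lower) auto
  have "\<zero>\<^bsub>M\<^esub> \<in> N" if "submodule N R M" for N
    using subgroup.one_closed[OF submodule.axioms(1)[OF that]] by simp
  then show "{\<zero>\<^bsub>M\<^esub>} \<subseteq> smult_span R M {}"
    by (auto simp: smult_span_def)
qed

context
  fixes K Q :: "'a::comm_ring_1 set"
  assumes K: "ideal K ring_of_type_algebra"
begin

interpretation K: ideal K "ring_of_type_algebra :: 'a ring" by (rule K)
interpretation M: module "ring_of_type_algebra :: 'a ring" "quot_module ring_of_type_algebra K"
  by (rule module_quot_module[OF cring_from_type_algebra K])

lemma coset_type_eq_iff:
  "K +>\<^bsub>ring_of_type_algebra\<^esub> a = K +>\<^bsub>ring_of_type_algebra\<^esub> b \<longleftrightarrow> a - b \<in> K"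
proof -
  have "a \<ominus>\<^bsub>ring_of_type_algebra\<^esub> b = a - b"
    using K.minus_equality[of "- b" b] by (simp add: a_minus_def)
  then show ?thesis
    using K.quotient_eq_iff_same_a_r_cos[OF K, of a b] by auto
qed

lemma quot_module_type_simps:
  "carrier (quot_module ring_of_type_algebra K) = range (\<lambda>f. K +>\<^bsub>ring_of_type_algebra\<^esub> f)"
  "\<zero>\<^bsub>quot_module ring_of_type_algebra K\<^esub> = K +>\<^bsub>ring_of_type_algebra\<^esub> 0"
  "a \<odot>\<^bsub>quot_module ring_of_type_algebra K\<^esub> (K +>\<^bsub>ring_of_type_algebra\<^esub> f) = K +>\<^bsub>ring_of_type_algebra\<^esub> (a * f)"
  "(K +>\<^bsub>ring_of_type_algebra\<^esub> f) \<oplus>\<^bsub>quot_module ring_of_type_algebra K\<^esub> (K +>\<^bsub>ring_of_type_algebra\<^esub> g)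
    = K +>\<^bsub>ring_of_type_algebra\<^esub> (f + g)"
proof -
  show "carrier (quot_module ring_of_type_algebra K) = range (\<lambda>f. K +>\<^bsub>ring_of_type_algebra\<^esub> f)"
    by (auto simp: FactRing_def A_RCOSETS_def')
  show "\<zero>\<^bsub>quot_module ring_of_type_algebra K\<^esub> = K +>\<^bsub>ring_of_type_algebra\<^esub> 0"
    using K.a_rcos_zero[OF K] K.a_rcos_const[of 0] ideal_typeD(1)[OF K] by (simp add: FactRing_def)
  show "a \<odot>\<^bsub>quot_module ring_of_type_algebra K\<^esub> (K +>\<^bsub>ring_of_type_algebra\<^esub> f) = K +>\<^bsub>ring_of_type_algebra\<^esub> (a * f)"
    using K.rcoset_mult_add[of a f] by (simp add: FactRing_def)
  show "(K +>\<^bsub>ring_of_type_algebra\<^esub> f) \<oplus>\<^bsub>quot_module ring_of_type_algebra K\<^esub> (K +>\<^bsub>ring_of_type_algebra\<^esub> g)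
    = K +>\<^bsub>ring_of_type_algebra\<^esub> (f + g)"
    using K.a_rcos_sum[of f g] by (simp add: FactRing_def)
qed

text \<open>Translates regularity of the first entry on the quotient module into the nonzerodivisor
  property modulo \<open>K\<close>.\<close>

lemma regular_head_iff:
  "(\<forall>x\<in>carrier (quot_module ring_of_type_algebra K).
      a \<odot>\<^bsub>quot_module ring_of_type_algebra K\<^esub> x \<in> smult_span ring_of_type_algebra (quot_module ring_of_type_algebra K) {} \<longrightarrow>
      x \<in> smult_span ring_of_type_algebra (quot_module ring_of_type_algebra K) {}) \<longleftrightarrow>
    (\<forall>x. a * x \<in> K \<longrightarrow> x \<in> K)"
  by (simp del: quot_module_simps add: M.smult_span_empty quot_module_type_simps coset_type_eq_iff)

lemma depth_ge_1_imp_nonzerodivisor: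
  assumes "depth ring_of_type_algebra Q (quot_module ring_of_type_algebra K) \<ge> 1"
  shows "\<exists>a\<in>Q. \<forall>x. a * x \<in> K \<longrightarrow> x \<in> K"
proof -
  have "\<exists>as. regular_sequence ring_of_type_algebra (quot_module ring_of_type_algebra K) as \<and> set as \<subseteq> Q \<and> as \<noteq> []"
  proof (rule ccontr)
    assume "\<not> ?thesis"
    \<comment> \<open>If at most the empty sequence is regular, every length in the supremum is
      0.\<close>
    then have "depth ring_of_type_algebra Q (quot_module ring_of_type_algebra K) \<le> 0"
      unfolding depth_def by (intro Sup_least) (auto simp: zero_enat_def)
    then show False using assms by simp
  qed
  then obtain as where as: "regular_sequence ring_of_type_algebra (quot_module ring_of_type_algebra K) as"
    "set as \<subseteq> Q" "as \<noteq> []" by blast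
  have "\<forall>x\<in>carrier (quot_module ring_of_type_algebra K).
      (as ! 0) \<odot>\<^bsub>quot_module ring_of_type_algebra K\<^esub> x
        \<in> smult_span ring_of_type_algebra (quot_module ring_of_type_algebra K) (set (take 0 as)) \<longrightarrow>
      x \<in> smult_span ring_of_type_algebra (quot_module ring_of_type_algebra K) (set (take 0 as))"
    using as(1,3) unfolding regular_sequence_def by blast
  then have "\<forall>x. (as ! 0) * x \<in> K \<longrightarrow> x \<in> K"
    using regular_head_iff[of "as ! 0"] by simp
  moreover have "as ! 0 \<in> Q" using as(2,3) by (simp add: subset_iff)
  ultimately show ?thesis by blast
qed

text \<open>A nonzerodivisor \<open>a\<close> in \<open>Q\<close> would give the regular sequence
  \<open>[a]\<close> and hence depth at least 1. The point to check is that a(A/K) is proper: it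
  lies in Q/K, which is proper because \<open>Q\<close> contains \<open>K\<close> but not 1.\<close>

lemma depth_0_imp_zerodivisors:
  assumes "depth ring_of_type_algebra Q (quot_module ring_of_type_algebra K) = 0"
    and Q: "ideal Q ring_of_type_algebra" "1 \<notin> Q" "K \<subseteq> Q" and a: "a \<in> Q"
  shows "\<exists>x. x \<notin> K \<and> a * x \<in> K"
proof (rule ccontr)
  assume "\<not> ?thesis"
  then have reg: "\<forall>x. a * x \<in> K \<longrightarrow> x \<in> K" by blast
  \<comment> \<open>The submodule Q/K of the quotient.\<close>
  define N where "N = (\<lambda>f. K +>\<^bsub>ring_of_type_algebra\<^esub> f) ` Q"
  note D = ideal_typeD[OF Q(1)]
  have "submodule N ring_of_type_algebra (quot_module ring_of_type_algebra K)"
  proof (rule M.submoduleI)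
    have sm: "r \<odot>\<^bsub>quot_module ring_of_type_algebra K\<^esub> x \<in> N" if "x \<in> N" for r x
      using that D(3) by (auto simp del: quot_module_simps simp: N_def quot_module_type_simps)
    show NC: "N \<subseteq> carrier (quot_module ring_of_type_algebra K)"
      by (auto simp del: quot_module_simps simp: N_def quot_module_type_simps)
    show "\<zero>\<^bsub>quot_module ring_of_type_algebra K\<^esub> \<in> N"
      using D(1) by (auto simp del: quot_module_simps simp: N_def quot_module_type_simps)
    show "\<ominus>\<^bsub>quot_module ring_of_type_algebra K\<^esub> x \<in> N" if "x \<in> N" for x
    proof -
      have "\<ominus>\<^bsub>quot_module ring_of_type_algebra K\<^esub> x =
          (\<ominus>\<^bsub>ring_of_type_algebra\<^esub> \<one>\<^bsub>ring_of_type_algebra\<^esub>) \<odot>\<^bsub>quot_module ring_of_type_algebra K\<^esub> x"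
        using NC that M.smult_l_minus[of "\<one>\<^bsub>ring_of_type_algebra\<^esub>" x] M.smult_one[of x]
        by (metis K.one_closed subsetD)
      then show ?thesis using sm[OF that] by (simp only:)
    qed
    show "x \<oplus>\<^bsub>quot_module ring_of_type_algebra K\<^esub> y \<in> N" if "x \<in> N" "y \<in> N" for x y
      using that D(2) by (auto simp del: quot_module_simps simp: N_def quot_module_type_simps)
    show "r \<odot>\<^bsub>quot_module ring_of_type_algebra K\<^esub> x \<in> N" if "x \<in> N" for r x by (rule sm[OF that])
  qed
  moreover have "{r \<odot>\<^bsub>quot_module ring_of_type_algebra K\<^esub> x | r x.
      r \<in> set [a] \<and> x \<in> carrier (quot_module ring_of_type_algebra K)} \<subseteq> N"
    using D(4)[OF a] by (auto simp del: quot_module_simps simp: N_def quot_module_type_simps)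
  ultimately have "smult_span ring_of_type_algebra (quot_module ring_of_type_algebra K) (set [a]) \<subseteq> N"
    unfolding smult_span_def by (intro Inter_lower) blast
  \<comment> \<open>If the coset of 1 were in Q/K, then 1 would be in Q + K = Q.\<close>
  moreover have "K +>\<^bsub>ring_of_type_algebra\<^esub> 1 \<notin> N"
  proof
    assume "K +>\<^bsub>ring_of_type_algebra\<^esub> 1 \<in> N"
    then obtain x where x: "x \<in> Q" "1 - x \<in> K" by (auto simp: N_def coset_type_eq_iff)
    have "1 - x + x \<in> Q" using x Q(3) D(2) by blast
    then show False using Q(2) by simp
  qed
  moreover have "K +>\<^bsub>ring_of_type_algebra\<^esub> 1 \<in> carrier (quot_module ring_of_type_algebra K)"
    by (simp del: quot_module_simps add: quot_module_type_simps)
  ultimately have "smult_span ring_of_type_algebra (quot_module ring_of_type_algebra K) (set [a])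
      \<noteq> carrier (quot_module ring_of_type_algebra K)"
    by blast
  then have "regular_sequence ring_of_type_algebra (quot_module ring_of_type_algebra K) [a]"
    unfolding regular_sequence_def using reg regular_head_iff[of a] by simp
  then have "enat (length [a]) \<le> depth ring_of_type_algebra Q (quot_module ring_of_type_algebra K)"
    unfolding depth_def using a by (intro Sup_upper) force
  then show False using assms(1) by (simp add: zero_enat_def)
qed

end

section \<open>Prime avoidance and zero divisors in noetherian rings\<close>

lemma prime_avoidance:
  fixes Q :: "'a::comm_ring_1 set"
  assumes "finite \<P>" and Q: "ideal Q ring_of_type_algebra"
    and "\<And>P. P \<in> \<P> \<Longrightarrow> primeideal P ring_of_type_algebra" and "Q \<subseteq> \<Union>\<P>"
  shows "\<exists>P\<in>\<P>. Q \<subseteq> P"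
  using assms(1,3,4)
proof (induction "card \<P>" arbitrary: \<P> rule: less_induct)
  case less
  note D = ideal_typeD[OF Q]
  have "\<P> \<noteq> {}" using less.prems(3) D(1) by auto
  then obtain P0 where P0: "P0 \<in> \<P>" by blast
  show ?case
  \<comment> \<open>A redundant prime is dropped by induction. If none is redundant, each prime
    \<open>P'\<close> has a witness \<open>a P'\<close> in \<open>Q\<close> that lies in
    \<open>P'\<close> and in no other member of the family.\<close>
  proof (cases "\<exists>P'\<in>\<P>. Q \<subseteq> \<Union>(\<P> - {P'})")
    case True
    then obtain P' where P': "P' \<in> \<P>" "Q \<subseteq> \<Union>(\<P> - {P'})" by blast
    have "\<exists>P\<in>\<P> - {P'}. Q \<subseteq> P"
      by (rule less.hyps) (use less.prems P' in \<open>auto simp only: card_Diff1_less finite_Diff Diff_iff\<close>)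
    then show ?thesis by blast
  next
    case False
    then have "\<forall>P'\<in>\<P>. \<exists>a. a \<in> Q \<and> a \<notin> \<Union>(\<P> - {P'})" by blast
    then obtain a where a: "\<And>P'. P' \<in> \<P> \<Longrightarrow> a P' \<in> Q \<and> a P' \<notin> \<Union>(\<P> - {P'})" by metis
    have aP: "a P' \<in> P'" if "P' \<in> \<P>" for P' using a[OF that] less.prems(3) by blast
    show ?thesis
    proof (cases "\<P> = {P0}")
      case True
      then show ?thesis using less.prems(3) by simp
    next
      case False
      then obtain P1 where P1: "P1 \<in> \<P>" "P1 \<noteq> P0" using P0 by blast
      \<comment> \<open>\<open>y\<close> lies in every prime except \<open>P0\<close>, while
        \<open>a P0\<close> lies in \<open>P0\<close> alone. Their sum lies in \<open>Q\<close> and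
        avoids all the primes; the second prime \<open>P1\<close> ensures that the product has a
        factor in \<open>Q\<close>.\<close>
      define y where "y = (\<Prod>P'\<in>\<P> - {P0}. a P')"
      have yin: "y \<in> L" if "ideal L ring_of_type_algebra" "P' \<in> \<P> - {P0}" "a P' \<in> L" for L P'
        using that less.prems(1) ideal_typeD(4)[of L "a P'"] unfolding y_def
        by (simp add: prod.remove[of _ P'])
      have pr: "primeideal P0 ring_of_type_algebra" using less.prems(2) P0 by blast
      have "(\<Prod>P'\<in>A. a P') \<notin> P0" if "finite A" "A \<subseteq> \<P> - {P0}" for A
        using that
      proof (induction A rule: finite_induct)
        case empty
        then show ?case using pr by (simp add: primeideal_type_iff)
      next
        case (insert P' A)
        then have "a P' \<notin> P0" using a[of P'] P0 by blast
        then show ?case using insert pr by (auto simp: primeideal_type_iff)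
      qed
      then have y0: "y \<notin> P0" using less.prems(1) unfolding y_def by blast
      have "a P0 + y \<in> Q" using D(2) a[OF P0] yin[OF Q, of P1] a P1 by blast
      then obtain P where P: "P \<in> \<P>" "a P0 + y \<in> P" using less.prems(3) by blast
      have Pid: "ideal P ring_of_type_algebra" using less.prems(2) P by (simp add: primeideal_type_iff)
      have False
      proof (cases "P = P0")
        case True
        then have "a P0 + y - a P0 \<in> P0" using ideal_typeD(6)[OF Pid] P aP[OF P0] by blast
        then show False using y0 by simp
      next
        case False
        then have "y \<in> P" using yin[OF Pid, of P] P aP by blast
        then have "a P0 + y - y \<in> P" using ideal_typeD(6)[OF Pid] P by blast
        then show False using a[OF P0] P False by auto
      qed
      then show ?thesis ..
    qed
  qed
qed

text \<open>In a noetherian ring a nonempty chain of ideals contains its union, which is the upper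
  bound that Zorn's lemma asks for.\<close>

lemma (in noetherian_ring) exists_maximal_ideal_in:
  assumes "\<A> \<noteq> {}" "\<And>K. K \<in> \<A> \<Longrightarrow> ideal K R"
  shows "\<exists>K\<in>\<A>. \<forall>L\<in>\<A>. K \<subseteq> L \<longrightarrow> L = K"
proof (rule subset_Zorn_nonempty[OF assms(1)])
  fix C assume C: "C \<noteq> {}" "subset.chain \<A> C"
  then have "subset.chain {I. ideal I R} C"
    using assms(2) by (auto simp: subset_chain_def)
  then have "\<Union>C \<in> C" by (rule ideal_chain_is_trivial[OF C(1)])
  then show "\<Union>C \<in> \<A>" using C(2) unfolding subset_chain_def by blast
qed

text \<open>Take a maximal ideal among those generated by finite subsets of \<open>G\<close>;
  adjoining one more element of \<open>G\<close> cannot enlarge it. The generators thus come from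
  \<open>G\<close> itself.\<close>

lemma noetherian_finite_generators:
  fixes G :: "'a::comm_ring_1 set"
  assumes "noetherian_ring (ring_of_type_algebra :: 'a ring)"
  shows "\<exists>G0\<subseteq>G. finite G0 \<and> G \<subseteq> Idl\<^bsub>ring_of_type_algebra\<^esub> G0"
proof -
  interpret noetherian_ring "ring_of_type_algebra :: 'a ring" by fact
  define \<A> where "\<A> = {Idl\<^bsub>ring_of_type_algebra\<^esub> G0 | G0. G0 \<subseteq> G \<and> finite G0}"
  have "\<A> \<noteq> {}" by (auto simp: \<A>_def)
  moreover have "ideal K ring_of_type_algebra" if "K \<in> \<A>" for K
    using that genideal_type_ideal by (auto simp: \<A>_def)
  ultimately obtain K where K: "K \<in> \<A>" and max: "\<And>L. L \<in> \<A> \<Longrightarrow> K \<subseteq> L \<Longrightarrow> L = K"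
    by (meson exists_maximal_ideal_in)
  then obtain G0 where G0: "K = Idl\<^bsub>ring_of_type_algebra\<^esub> G0" "G0 \<subseteq> G" "finite G0" by (auto simp: \<A>_def)
  have "g \<in> K" if "g \<in> G" for g
  proof -
    have "Idl\<^bsub>ring_of_type_algebra\<^esub> (insert g G0) = K"
    proof (rule max)
      show "Idl\<^bsub>ring_of_type_algebra\<^esub> (insert g G0) \<in> \<A>" using G0 that by (auto simp: \<A>_def)
      show "K \<subseteq> Idl\<^bsub>ring_of_type_algebra\<^esub> (insert g G0)"
        unfolding G0(1) using genideal_type_self[of "insert g G0"]
        by (intro genideal_type_minimal genideal_type_ideal) auto
    qed
    then show ?thesis using genideal_type_self[of "insert g G0"] by auto
  qed
  then show ?thesis using G0 by blast
qed

text \<open>The maximal ideals of the form \<open>K : f\<close> with \<open>f \<notin> K\<close> are prime and finite in number, and they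
  cover the zero divisors modulo \<open>K\<close>; prime avoidance puts \<open>Q\<close> inside one of them.\<close>

lemma noetherian_zerodivisors_annihilator:
  fixes K Q :: "'a::comm_ring_1 set"
  assumes noeth: "noetherian_ring (ring_of_type_algebra :: 'a ring)"
    and K: "ideal K ring_of_type_algebra" and Q: "ideal Q ring_of_type_algebra"
    and zd: "\<And>a. a \<in> Q \<Longrightarrow> \<exists>x. x \<notin> K \<and> a * x \<in> K"
  shows "\<exists>f. f \<notin> K \<and> (\<forall>a\<in>Q. a * f \<in> K)"
proof -
  interpret noetherian_ring "ring_of_type_algebra :: 'a ring" by fact
  note D = ideal_typeD[OF K]
  define ann where "ann f = {a. a * f \<in> K}" for f
  have id: "ideal (ann f) ring_of_type_algebra" for f
    using D by (auto simp: ideal_type_iff ann_def distrib_right mult.assoc)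
  \<comment> \<open>The elements outside \<open>K\<close> whose colon ideal is maximal among all
    colon ideals of elements outside \<open>K\<close>.\<close>
  define G where "G = {f. f \<notin> K \<and> (\<forall>g. g \<notin> K \<longrightarrow> ann f \<subseteq> ann g \<longrightarrow> ann g = ann f)}"
  have ex: "\<exists>g\<in>G. ann f \<subseteq> ann g" if "f \<notin> K" for f
  proof -
    define \<A> where "\<A> = {ann g | g. g \<notin> K \<and> ann f \<subseteq> ann g}"
    have "\<A> \<noteq> {}" using that by (auto simp: \<A>_def)
    moreover have "ideal L ring_of_type_algebra" if "L \<in> \<A>" for L
      using that id by (auto simp: \<A>_def)
    ultimately obtain L where L: "L \<in> \<A>" "\<And>L'. L' \<in> \<A> \<Longrightarrow> L \<subseteq> L' \<Longrightarrow> L' = L"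
      by (meson exists_maximal_ideal_in)
    then obtain g where g: "L = ann g" "g \<notin> K" "ann f \<subseteq> ann g" by (auto simp: \<A>_def)
    have "g \<in> G"
      unfolding G_def using L(2) g unfolding \<A>_def by blast
    then show ?thesis using g by blast
  qed
  \<comment> \<open>If \<open>b\<close> is not in K : f, then b * f is outside \<open>K\<close> and
    its colon ideal contains K : f; maximality makes the two equal, which gives primality.\<close>
  have prime: "primeideal (ann f) ring_of_type_algebra" if "f \<in> G" for f
    unfolding primeideal_type_iff
  proof (intro conjI allI impI id)
    show "1 \<notin> ann f" using that by (simp add: ann_def G_def)
    fix a b assume ab: "a * b \<in> ann f"
    show "a \<in> ann f \<or> b \<in> ann f"
    proof (rule disjCI)
      assume b: "b \<notin> ann f"
      have "ann f \<subseteq> ann (b * f)"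
      proof
        fix x assume "x \<in> ann f"
        then have "b * (x * f) \<in> K" using D(3) by (simp add: ann_def)
        then show "x \<in> ann (b * f)" by (simp only: ann_def mult.left_commute mem_Collect_eq)
      qed
      then have "ann (b * f) = ann f" using that b by (auto simp: G_def ann_def)
      moreover have "a \<in> ann (b * f)" using ab by (simp add: ann_def mult.assoc)
      ultimately show "a \<in> ann f" by simp
    qed
  qed
  obtain G0 where G0: "G0 \<subseteq> G" "finite G0" "G \<subseteq> Idl\<^bsub>ring_of_type_algebra\<^esub> G0"
    using noetherian_finite_generators[OF noeth] by blast
  \<comment> \<open>If K : f differed from all K : g with g in \<open>G0\<close>, maximality would
    give elements \<open>a g\<close> in K : g outside K : f. Their product sends all of
    \<open>G0\<close>, hence also \<open>f\<close>, into \<open>K\<close>, yet it stays outside the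
    prime K : f.\<close>
  have fin: "\<exists>g\<in>G0. ann f = ann g" if f: "f \<in> G" for f
  proof (rule ccontr)
    assume no: "\<not> ?thesis"
    have "\<exists>a. a \<in> ann g \<and> a \<notin> ann f" if g: "g \<in> G0" for g
    proof -
      have "ann f \<noteq> ann g" using no g by blast
      moreover have "f \<notin> K" using f by (simp add: G_def)
      moreover have "g \<in> G" using g G0 by blast
      ultimately show ?thesis unfolding G_def by blast
    qed
    then obtain a where a: "\<And>g. g \<in> G0 \<Longrightarrow> a g \<in> ann g \<and> a g \<notin> ann f" by metis
    have "prod a A \<notin> ann f" if "finite A" "A \<subseteq> G0" for A
      using that
    proof (induction A rule: finite_induct)
      case empty
      then show ?case using f by (simp add: ann_def G_def)
    next
      case (insert g A)
      then show ?case using a[of g] prime[OF f] by (auto simp: primeideal_type_iff)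
    qed
    then have "prod a G0 \<notin> ann f" using G0(2) by blast
    moreover have "ideal {h. prod a G0 * h \<in> K} ring_of_type_algebra"
      using D by (auto simp: ideal_type_iff distrib_left mult.left_commute)
    then have "Idl\<^bsub>ring_of_type_algebra\<^esub> G0 \<subseteq> {h. prod a G0 * h \<in> K}"
    proof (rule genideal_type_minimal, intro subsetI CollectI)
      fix g assume g: "g \<in> G0"
      have "prod a (G0 - {g}) * (a g * g) \<in> K"
        using a[OF g] D(3) by (simp add: ann_def)
      then show "prod a G0 * g \<in> K" using G0(2) g by (simp add: prod.remove[of _ g] mult_ac)
    qed
    then have "prod a G0 \<in> ann f" using G0(3) f by (auto simp: ann_def)
    ultimately show False by contradiction
  qed
  have "Q \<subseteq> \<Union>(ann ` G0)"
  proof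
    fix a assume "a \<in> Q"
    then obtain x where x: "x \<notin> K" "a \<in> ann x" using zd by (auto simp: ann_def)
    then obtain f where "f \<in> G" "a \<in> ann f" using ex by blast
    then show "a \<in> \<Union>(ann ` G0)" using fin by blast
  qed
  then obtain g where "g \<in> G0" "Q \<subseteq> ann g"
    using prime_avoidance[of "ann ` G0" Q] G0(1,2) Q prime by blast
  then show ?thesis using G0(1) by (auto simp: G_def ann_def)
qed

section \<open>Hilbert's basis theorem\<close>

lemma poly_mapping_sum_single:
  fixes f :: "'a \<Rightarrow>\<^sub>0 'b::comm_monoid_add"
  shows "(\<Sum>e\<in>Poly_Mapping.keys f. Poly_Mapping.single e (Poly_Mapping.lookup f e)) = f"
proof (rule poly_mapping_eqI)
  fix k
  have "(\<Sum>e\<in>Poly_Mapping.keys f. Poly_Mapping.lookup f e when e = k) = Poly_Mapping.lookup f k"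
    by (simp add: when_def in_keys_iff)
  then show "Poly_Mapping.lookup (\<Sum>e\<in>Poly_Mapping.keys f. Poly_Mapping.single e (Poly_Mapping.lookup f e)) k =
      Poly_Mapping.lookup f k"
    by (simp add: lookup_sum lookup_single)
qed

text \<open>A polynomial is the sum of its terms, so additive identities can be checked on single
  terms, and bilinear ones by applying this twice.\<close>

lemma poly_mapping_single_induct [case_names zero single add]:
  fixes f :: "'a \<Rightarrow>\<^sub>0 'b::comm_monoid_add"
  assumes "P 0" "\<And>e c. P (Poly_Mapping.single e c)" "\<And>f g. P f \<Longrightarrow> P g \<Longrightarrow> P (f + g)"
  shows "P f"
proof -
  have "P (\<Sum>e\<in>A. Poly_Mapping.single e (Poly_Mapping.lookup f e))" for A
    by (induction A rule: infinite_finite_induct) (auto intro: assms)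
  then show ?thesis by (metis poly_mapping_sum_single)
qed

lemma lookup_single_mult:
  fixes p :: "('a::cancel_comm_monoid_add \<Rightarrow>\<^sub>0 'b::comm_semiring_1)"
  shows "Poly_Mapping.lookup (Poly_Mapping.single d c * p) (d + k) = c * Poly_Mapping.lookup p k"
  by (induction p rule: poly_mapping_single_induct)
    (auto simp: mult_single lookup_single lookup_add distrib_left when_def)

lemma rename_exponent_add:
  assumes "inj \<phi>"
  shows "rename_exponent \<phi> (d + e) = rename_exponent \<phi> d + rename_exponent \<phi> e"
proof (rule poly_mapping_eqI)
  fix k
  show "Poly_Mapping.lookup (rename_exponent \<phi> (d + e)) k =
      Poly_Mapping.lookup (rename_exponent \<phi> d + rename_exponent \<phi> e) k"
    by (cases "k \<in> range \<phi>")
      (auto simp: lookup_rename_exponent[OF assms] lookup_rename_exponent_other lookup_add)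
qed

lemma inj_rename_exponent:
  assumes "inj \<phi>"
  shows "inj (rename_exponent \<phi>)"
  using lookup_rename_exponent[OF assms] by (intro injI poly_mapping_eqI) metis

section \<open>Dickson's lemma on exponent vectors\<close>

lemma monotone_subsequence_nat:
  fixes s :: "nat \<Rightarrow> nat"
  shows "\<exists>r :: nat \<Rightarrow> nat. strict_mono r \<and> mono (\<lambda>n. s (r n))"
proof -
  obtain r where r: "strict_mono r" "monoseq (\<lambda>n. s (r n))"
    using seq_monosub by blast
  from r(2) show ?thesis unfolding monoseq_iff
  proof
    assume "incseq (\<lambda>n. s (r n))"
    with r(1) show ?thesis by blast
  next
    assume dec: "decseq (\<lambda>n. s (r n))"
    \<comment> \<open>A decreasing sequence of naturals is constant once it reaches its minimum, so
      its tail is also nondecreasing.\<close>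
    define m where "m = (LEAST m. m \<in> range (\<lambda>n. s (r n)))"
    have "m \<in> range (\<lambda>n. s (r n))" unfolding m_def by (rule LeastI_ex) blast
    then obtain N where N: "m = s (r N)" by blast
    have "s (r (n + N)) = m" for n
    proof (rule antisym)
      show "s (r (n + N)) \<le> m" using dec N by (simp add: decseq_def)
      show "m \<le> s (r (n + N))" unfolding m_def by (rule Least_le) blast
    qed
    moreover have "strict_mono (\<lambda>n. r (n + N))" using r(1) by (simp add: strict_mono_def)
    ultimately show ?thesis by (intro exI[of _ "\<lambda>n. r (n + N)"]) (simp add: mono_def)
  qed
qed

text \<open>Treating the finitely many variables one at a time yields a subsequence along which
  every exponent is nondecreasing; its first two members are comparable.\<close>

lemma dickson:
  fixes e :: "nat \<Rightarrow> ('v::finite \<Rightarrow>\<^sub>0 nat)"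
  shows "\<exists>i j d. i < j \<and> e j = e i + d"
proof -
  have "\<exists>r :: nat \<Rightarrow> nat. strict_mono r \<and> (\<forall>v\<in>V. mono (\<lambda>n. Poly_Mapping.lookup (e (r n)) v))" if "finite V" for V
    using that
  proof (induction V rule: finite_induct)
    case empty
    show ?case by (intro exI[of _ id]) (simp add: strict_mono_def)
  next
    case (insert v V)
    then obtain r :: "nat \<Rightarrow> nat" where r: "strict_mono r" "\<forall>v\<in>V. mono (\<lambda>n. Poly_Mapping.lookup (e (r n)) v)" by blast
    obtain r' :: "nat \<Rightarrow> nat" where r': "strict_mono r'" "mono (\<lambda>n. Poly_Mapping.lookup (e (r (r' n))) v)"
      using monotone_subsequence_nat[of "\<lambda>n. Poly_Mapping.lookup (e (r n)) v"] by blast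
    have "strict_mono (\<lambda>n. r (r' n))" using r(1) r'(1) by (simp add: strict_mono_def)
    moreover have "mono (\<lambda>n. Poly_Mapping.lookup (e (r (r' n))) w)" if "w \<in> V" for w
    proof (rule monoI)
      fix x y :: nat assume "x \<le> y"
      then have "r' x \<le> r' y" using r'(1) by (simp add: strict_mono_less_eq)
      then show "Poly_Mapping.lookup (e (r (r' x))) w \<le> Poly_Mapping.lookup (e (r (r' y))) w"
        using r(2) that by (auto simp: mono_def)
    qed
    ultimately show ?case using r'(2) by (intro exI[of _ "\<lambda>n. r (r' n)"]) simp
  qed
  from this[of UNIV] obtain r :: "nat \<Rightarrow> nat" where r: "strict_mono r" "\<And>v. mono (\<lambda>n. Poly_Mapping.lookup (e (r n)) v)"
    by auto
  have "Poly_Mapping.lookup (e (r 0)) v \<le> Poly_Mapping.lookup (e (r 1)) v" for v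
    using r(2)[of v] by (simp add: mono_def)
  \<comment> \<open>Subtraction of naturals is truncated; the preceding inequalities make it
    exact.\<close>
  then have "e (r 1) = e (r 0) + (e (r 1) - e (r 0))"
    by (intro poly_mapping_eqI) (simp add: lookup_add lookup_minus)
  moreover have "r 0 < r 1" using r(1) by (simp add: strict_mono_def)
  ultimately show ?thesis by blast
qed

text \<open>The order compares lexicographically at the first differing index, where no natural
  number is below 0.\<close>

lemma zero_le_poly_mapping_nat: "0 \<le> (e :: nat \<Rightarrow>\<^sub>0 nat)"
proof -
  have "\<not> e < 0"
    by transfer (simp add: less_fun_def)
  then show ?thesis by simp
qed

text \<open>Via an injection of the variables into \<open>nat\<close>, the order of \<^typ>\<open>nat \<Rightarrow>\<^sub>0 nat\<close> is a monomial order.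
  Choose successively elements of \<open>L\<close> of least leading exponent outside the ideal of the earlier
  ones. By Dickson some leading monomial divides a later one, and cancelling the leading term of the
  latter contradicts its choice.\<close>

theorem hilbert_basis: "noetherian_ring (polynomial_ring :: ('v::finite, 'k::field) mpoly ring)"
proof (rule ring.noetherian_ringI[OF ring_from_type_algebra], rule ccontr)
  fix L :: "('v, 'k) mpoly set"
  assume L: "ideal L polynomial_ring"
    and nfg: "\<not> (\<exists>A\<subseteq>carrier polynomial_ring. finite A \<and> L = Idl\<^bsub>polynomial_ring\<^esub> A)"
  obtain \<iota> :: "'v \<Rightarrow> nat" where \<iota>: "inj \<iota>"
    using finite_imp_inj_to_nat_seg[OF finite_UNIV] by blast
  define \<nu> where "\<nu> = rename_exponent \<iota>"
  have add: "\<nu> (a + b) = \<nu> a + \<nu> b" for a b unfolding \<nu>_def by (rule rename_exponent_add[OF \<iota>])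
  have inj: "\<nu> a = \<nu> b \<longleftrightarrow> a = b" for a b
    unfolding \<nu>_def by (rule inj_eq[OF inj_rename_exponent[OF \<iota>]])
  have le_add: "\<nu> a \<le> \<nu> (a + b)" for a b
    using add_left_mono[OF zero_le_poly_mapping_nat[of "\<nu> b"], of "\<nu> a"] by (simp add: add)
  \<comment> \<open>An infinite descent would contradict Dickson: some later exponent is a sum of an
    earlier one and a vector, and adding a vector never decreases \<open>\<nu>\<close>.\<close>
  have wf: "wf {(a, b). \<nu> a < \<nu> b}"
    unfolding wf_iff_no_infinite_down_chain
  proof
    assume "\<exists>f. \<forall>i. (f (Suc i), f i) \<in> {(a, b). \<nu> a < \<nu> b}"
    then obtain f where f: "\<And>i. \<nu> (f (Suc i)) < \<nu> (f i)" by auto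
    have dec: "\<nu> (f j) < \<nu> (f i)" if "i < j" for i j
      using that by (induction j) (auto simp: less_Suc_eq intro: f less_trans)
    show False using dickson[of f] dec le_add by (metis leD)
  qed
  \<comment> \<open>This provides the leading exponent \<open>l p\<close>; nothing is claimed about
    its value at the zero polynomial.\<close>
  have "\<exists>a. p \<noteq> 0 \<longrightarrow> a \<in> Poly_Mapping.keys p \<and> (\<forall>b\<in>Poly_Mapping.keys p. \<nu> b \<le> \<nu> a)" for p :: "('v, 'k) mpoly"
  proof (cases "p = 0")
    case False
    then have "Max (\<nu> ` Poly_Mapping.keys p) \<in> \<nu> ` Poly_Mapping.keys p" by (intro Max_in) auto
    then obtain a where "a \<in> Poly_Mapping.keys p" "\<nu> a = Max (\<nu> ` Poly_Mapping.keys p)" by auto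
    then show ?thesis by auto
  qed simp
  then obtain l where l: "\<And>p :: ('v, 'k) mpoly. p \<noteq> 0 \<Longrightarrow>
      l p \<in> Poly_Mapping.keys p \<and> (\<forall>b\<in>Poly_Mapping.keys p. \<nu> b \<le> \<nu> (l p))"
    by metis
  have "\<exists>p. p \<in> L - Idl\<^bsub>polynomial_ring\<^esub> G \<and> (\<forall>q\<in>L - Idl\<^bsub>polynomial_ring\<^esub> G. \<not> \<nu> (l q) < \<nu> (l p))"
    if G: "finite G" "G \<subseteq> L" for G
  proof -
    have "L \<noteq> Idl\<^bsub>polynomial_ring\<^esub> G" using nfg G by auto
    then obtain q where "q \<in> L - Idl\<^bsub>polynomial_ring\<^esub> G"
      using genideal_type_minimal[OF L G(2)] by blast
    from wfE_min[OF wf_inv_image[OF wf, of l] this]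
    obtain p where "p \<in> L - Idl\<^bsub>polynomial_ring\<^esub> G"
      "\<And>q. (q, p) \<in> inv_image {(a, b). \<nu> a < \<nu> b} l \<Longrightarrow> q \<notin> L - Idl\<^bsub>polynomial_ring\<^esub> G" by blast
    then show ?thesis by (intro exI[of _ p]) auto
  qed
  then obtain pick where pick: "\<And>G. finite G \<Longrightarrow> G \<subseteq> L \<Longrightarrow> pick G \<in> L - Idl\<^bsub>polynomial_ring\<^esub> G \<and>
      (\<forall>q\<in>L - Idl\<^bsub>polynomial_ring\<^esub> G. \<not> \<nu> (l q) < \<nu> (l (pick G)))"
    by metis
  \<comment> \<open>\<open>G n\<close> holds the first n chosen elements, and \<open>f n\<close> is
    the next choice.\<close>
  define G where "G n = ((\<lambda>G. insert (pick G) G) ^^ n) {}" for n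
  define f where "f n = pick (G n)" for n
  have G_Suc: "G (Suc n) = insert (f n) (G n)" for n by (simp add: G_def f_def)
  have G: "finite (G n) \<and> G n \<subseteq> L" for n
  proof (induction n)
    case (Suc n)
    then show ?case using pick[of "G n"] by (simp add: G_Suc f_def)
  qed (simp add: G_def)
  have f: "f n \<in> L - Idl\<^bsub>polynomial_ring\<^esub> (G n)"
    "q \<in> L - Idl\<^bsub>polynomial_ring\<^esub> (G n) \<Longrightarrow> \<not> \<nu> (l q) < \<nu> (l (f n))" for n q
    using pick[of "G n"] G[of n] unfolding f_def by blast+
  have fG: "f i \<in> G j" if "i < j" for i j
    using that by (induction j) (auto simp: G_Suc less_Suc_eq)
  obtain i j d where ij: "i < j" and d: "l (f j) = l (f i) + d"
    using dickson[of "\<lambda>n. l (f n)"] by auto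
  note DL = ideal_typeD[OF L] and DG = ideal_typeD[OF genideal_type_ideal[of "G j"]]
  have nz: "f n \<noteq> 0" for n using f(1)[of n] ideal_typeD(1)[OF genideal_type_ideal[of "G n"]] by auto
  \<comment> \<open>The scalar \<open>c\<close> and the shift \<open>d\<close> match the leading
    term of \<open>f j\<close> with a multiple of \<open>f i\<close>. The difference
    \<open>g\<close> stays outside the ideal of \<open>G j\<close>, since otherwise
    \<open>f j\<close> would be inside.\<close>
  define c where "c = Poly_Mapping.lookup (f j) (l (f j)) / Poly_Mapping.lookup (f i) (l (f i))"
  define g where "g = f j - Poly_Mapping.single d c * f i"
  have "f i \<in> Idl\<^bsub>polynomial_ring\<^esub> (G j)" using fG[OF ij] genideal_type_self by blast
  then have si: "Poly_Mapping.single d c * f i \<in> Idl\<^bsub>polynomial_ring\<^esub> (G j)" by (rule DG(3))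
  have gL: "g \<in> L - Idl\<^bsub>polynomial_ring\<^esub> (G j)"
  proof
    show "g \<in> L" unfolding g_def using f(1) DL(3,6) by blast
    show "g \<notin> Idl\<^bsub>polynomial_ring\<^esub> (G j)"
    proof
      assume "g \<in> Idl\<^bsub>polynomial_ring\<^esub> (G j)"
      from DG(2)[OF this si] show False using f(1)[of j] by (simp add: g_def)
    qed
  qed
  then have "g \<noteq> 0" using DG(1) by auto
  have lk: "Poly_Mapping.lookup g (l (f j)) = 0"
    using l[OF nz[of i]] lookup_single_mult[of d c "f i" "l (f i)"]
    by (simp add: g_def lookup_minus c_def d add.commute in_keys_iff)
  have "\<nu> k \<le> \<nu> (l (f j))" if "k \<in> Poly_Mapping.keys g" for k
  proof -
    have "k \<in> Poly_Mapping.keys (f j) \<or> k \<in> Poly_Mapping.keys (Poly_Mapping.single d c * f i)"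
      using that by (auto simp: g_def in_keys_iff lookup_minus)
    then show ?thesis
    proof
      assume "k \<in> Poly_Mapping.keys (Poly_Mapping.single d c * f i)"
      then obtain k' where "k' \<in> Poly_Mapping.keys (f i)" "k = d + k'"
        using keys_mult[of "Poly_Mapping.single d c" "f i"] by (auto split: if_splits)
      then show ?thesis
        using l[OF nz[of i]] by (auto simp: d add add.commute intro!: add_left_mono)
    qed (use l[OF nz] in auto)
  qed
  moreover have "l g \<in> Poly_Mapping.keys g" using l[OF \<open>g \<noteq> 0\<close>] by blast
  moreover from this lk have "l g \<noteq> l (f j)" by (auto simp: in_keys_iff)
  ultimately have "\<nu> (l g) < \<nu> (l (f j))" by (simp add: less_le inj)
  then show False using f(2)[OF gL] by contradiction
qed

section \<open>Restriction of polynomials to a subset of the variables\<close>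

lemma range_rename_exponent_iff:
  assumes "inj \<phi>"
  shows "e \<in> range (rename_exponent \<phi>) \<longleftrightarrow> Poly_Mapping.keys e \<subseteq> range \<phi>"
proof
  assume "Poly_Mapping.keys e \<subseteq> range \<phi>"
  then have other: "Poly_Mapping.lookup e k = 0" if "k \<notin> range \<phi>" for k
    using that by (auto simp: in_keys_iff)
  have "rename_exponent \<phi> (Poly_Mapping.map_key \<phi> e) = e"
  proof (rule poly_mapping_eqI)
    fix k
    show "Poly_Mapping.lookup (rename_exponent \<phi> (Poly_Mapping.map_key \<phi> e)) k = Poly_Mapping.lookup e k"
      by (cases "k \<in> range \<phi>")
        (auto simp: lookup_rename_exponent[OF assms] map_key.rep_eq[OF assms]
          lookup_rename_exponent_other other)
  qed
  then show "e \<in> range (rename_exponent \<phi>)" by (metis rangeI)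
next
  assume "e \<in> range (rename_exponent \<phi>)"
  then show "Poly_Mapping.keys e \<subseteq> range \<phi>"
    using lookup_rename_exponent_other[of _ \<phi>] by (fastforce simp: in_keys_iff)
qed

lemma rename_exponent_0 [simp]: "rename_exponent \<phi> 0 = 0"
  by (simp add: rename_exponent_def)

lemma rename_exponent_single: "rename_exponent \<phi> (Poly_Mapping.single i n) = Poly_Mapping.single (\<phi> i) n"
  by (cases "n = 0") (simp_all add: rename_exponent_def)

lemma lookup_rename:
  fixes f :: "('v, 'k::comm_ring_1) mpoly"
  assumes "inj \<phi>"
  shows "Poly_Mapping.lookup (rename \<phi> f) (rename_exponent \<phi> e) = Poly_Mapping.lookup f e"
proof -
  have "Poly_Mapping.lookup (rename \<phi> f) (rename_exponent \<phi> e) =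
      (\<Sum>d\<in>Poly_Mapping.keys f. Poly_Mapping.lookup f d when d = e)"
    using inj_eq[OF inj_rename_exponent[OF assms]] by (simp add: rename_def lookup_sum lookup_single)
  also have "\<dots> = Poly_Mapping.lookup f e"
    by (simp add: when_def in_keys_iff)
  finally show ?thesis .
qed

lemma lookup_rename_other:
  "e \<notin> range (rename_exponent \<phi>) \<Longrightarrow> Poly_Mapping.lookup (rename \<phi> f) e = 0"
  by (auto simp: rename_def lookup_sum lookup_single when_def intro!: sum.neutral)

lemma rename_variable: "rename \<phi> (variable i) = variable (\<phi> i)"
  by (simp add: variable_def rename_single rename_exponent_single)

text \<open>For injective \<open>\<phi>\<close> this sets the variables outside the range of
  \<open>\<phi>\<close> to zero and pulls the remaining monomials back; it is a ring retraction of
  \<open>rename \<phi>\<close>.\<close>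

definition restrict_vars :: "('v \<Rightarrow> 'w) \<Rightarrow> ('w, 'k::comm_ring_1) mpoly \<Rightarrow> ('v, 'k) mpoly" where
  "restrict_vars \<phi> f = Poly_Mapping.map_key (rename_exponent \<phi>) f"

context
  fixes \<phi> :: "'v \<Rightarrow> 'w"
  assumes inj: "inj \<phi>"
begin

lemma lookup_restrict_vars: "Poly_Mapping.lookup (restrict_vars \<phi> f) e = Poly_Mapping.lookup f (rename_exponent \<phi> e)"
  by (simp add: restrict_vars_def map_key.rep_eq[OF inj_rename_exponent[OF inj]])

lemma restrict_vars_0 [simp]: "restrict_vars \<phi> 0 = 0"
  by (rule poly_mapping_eqI) (simp add: lookup_restrict_vars)

lemma restrict_vars_add: "restrict_vars \<phi> (f + g) = restrict_vars \<phi> f + restrict_vars \<phi> g"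
  by (rule poly_mapping_eqI) (simp add: lookup_restrict_vars lookup_add)

lemma restrict_vars_rename: "restrict_vars \<phi> (rename \<phi> f) = f"
  by (rule poly_mapping_eqI) (simp add: lookup_restrict_vars lookup_rename[OF inj])

lemma restrict_vars_single:
  "restrict_vars \<phi> (Poly_Mapping.single (rename_exponent \<phi> e) c) = Poly_Mapping.single e c"
  "e' \<notin> range (rename_exponent \<phi>) \<Longrightarrow> restrict_vars \<phi> (Poly_Mapping.single e' c) = 0"
  using inj_eq[OF inj_rename_exponent[OF inj]]
  by (auto intro!: poly_mapping_eqI simp: lookup_restrict_vars lookup_single when_def)

text \<open>On monomials the claim holds because exponents cannot cancel: a + b is supported in the
  range of \<open>\<phi>\<close> iff both a and b are. Bilinearity does the rest.\<close>

lemma restrict_vars_mult: "restrict_vars \<phi> (f * g) = restrict_vars \<phi> f * restrict_vars \<phi> g"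
proof (induction f rule: poly_mapping_single_induct)
  case (single a c)
  show ?case
  proof (induction g rule: poly_mapping_single_induct)
    case (single b d)
    have keys: "Poly_Mapping.keys (a + b) = Poly_Mapping.keys a \<union> Poly_Mapping.keys b"
      by (auto simp: in_keys_iff lookup_add)
    show ?case
    proof (cases "a + b \<in> range (rename_exponent \<phi>)")
      case True
      then obtain a' b' where "a = rename_exponent \<phi> a'" "b = rename_exponent \<phi> b'"
        using range_rename_exponent_iff[OF inj] keys by (metis Un_subset_iff rangeE)
      then show ?thesis
        by (simp add: mult_single restrict_vars_single rename_exponent_add[OF inj, symmetric])
    next
      case False
      then have "a \<notin> range (rename_exponent \<phi>) \<or> b \<notin> range (rename_exponent \<phi>)"
        using range_rename_exponent_iff[OF inj] keys by (metis Un_subset_iff)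
      with False show ?thesis by (auto simp: mult_single restrict_vars_single(2))
    qed
  qed (simp_all add: distrib_left restrict_vars_add)
qed (simp_all add: distrib_right restrict_vars_add)

lemma ideal_restrict_vars_preimage:
  "ideal I polynomial_ring \<Longrightarrow> ideal {f :: ('w, 'k::comm_ring_1) mpoly. restrict_vars \<phi> f \<in> I} polynomial_ring"
  by (simp add: ideal_type_iff restrict_vars_add restrict_vars_mult)

end

section \<open>Homogeneous ideals\<close>

lemma exponent_degree_alt:
  fixes e :: "'v \<Rightarrow>\<^sub>0 nat"
  assumes "finite A" "Poly_Mapping.keys e \<subseteq> A"
  shows "exponent_degree e = (\<Sum>i\<in>A. Poly_Mapping.lookup e i)"
  unfolding exponent_degree_def using assms by (intro sum.mono_neutral_left) (auto simp: in_keys_iff)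

lemma exponent_degree_add: "exponent_degree (d + e) = exponent_degree d + exponent_degree e"
proof -
  let ?A = "Poly_Mapping.keys d \<union> Poly_Mapping.keys e"
  have "Poly_Mapping.keys (d + e) \<subseteq> ?A" by (rule Poly_Mapping.keys_add)
  then show ?thesis
    using exponent_degree_alt[of ?A d] exponent_degree_alt[of ?A e] exponent_degree_alt[of ?A "d + e"]
    by (simp add: lookup_add sum.distrib)
qed

lemma exponent_degree_eq_0_iff [simp]: "exponent_degree e = 0 \<longleftrightarrow> e = 0"
  by (auto simp: exponent_degree_def in_keys_iff intro!: poly_mapping_eqI)

lemma exponent_degree_single [simp]: "exponent_degree (Poly_Mapping.single i n) = n"
  by (cases "n = 0") (simp_all add: exponent_degree_def)

lemma exponent_degree_rename:
  assumes "inj \<phi>"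
  shows "exponent_degree (rename_exponent \<phi> e) = exponent_degree e"
proof -
  have "exponent_degree (rename_exponent \<phi> e) =
      (\<Sum>i\<in>\<phi> ` Poly_Mapping.keys e. Poly_Mapping.lookup (rename_exponent \<phi> e) i)"
  proof (rule exponent_degree_alt)
    show "Poly_Mapping.keys (rename_exponent \<phi> e) \<subseteq> \<phi> ` Poly_Mapping.keys e"
    proof
      fix j assume j: "j \<in> Poly_Mapping.keys (rename_exponent \<phi> e)"
      then have "j \<in> range \<phi>"
        by (rule contrapos_pp) (simp add: in_keys_iff lookup_rename_exponent_other)
      then obtain i where "j = \<phi> i" by blast
      with j show "j \<in> \<phi> ` Poly_Mapping.keys e"
        by (simp add: in_keys_iff lookup_rename_exponent[OF assms])
    qed
  qed simp
  also have "\<dots> = exponent_degree e"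
    using inj_on_subset[OF assms subset_UNIV]
    by (simp add: sum.reindex lookup_rename_exponent[OF assms] exponent_degree_def)
  finally show ?thesis .
qed

lemma lookup_homogeneous_component:
  "Poly_Mapping.lookup (homogeneous_component d f) e = (if exponent_degree e = d then Poly_Mapping.lookup f e else 0)"
  by (simp add: homogeneous_component.rep_eq)

lemma homogeneous_component_0 [simp]: "homogeneous_component d 0 = 0"
  by (rule poly_mapping_eqI) (simp add: lookup_homogeneous_component)

lemma homogeneous_component_add:
  "homogeneous_component d (f + g) = homogeneous_component d f + homogeneous_component d (g :: ('v, 'k::comm_ring_1) mpoly)"
  by (rule poly_mapping_eqI) (simp add: lookup_homogeneous_component lookup_add)

lemma homogeneous_component_single:
  "homogeneous_component d (Poly_Mapping.single e c) =
    (if exponent_degree e = d then Poly_Mapping.single e c else 0)"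
  by (rule poly_mapping_eqI) (auto simp: lookup_homogeneous_component lookup_single when_def)

lemma sum_homogeneous_component:
  fixes f :: "('v, 'k::comm_ring_1) mpoly"
  shows "(\<Sum>d\<in>exponent_degree ` Poly_Mapping.keys f. homogeneous_component d f) = f"
proof (rule poly_mapping_eqI)
  fix e
  show "Poly_Mapping.lookup (\<Sum>d\<in>exponent_degree ` Poly_Mapping.keys f. homogeneous_component d f) e =
      Poly_Mapping.lookup f e"
    by (auto simp: lookup_sum lookup_homogeneous_component in_keys_iff)
qed

text \<open>By bilinearity it suffices to multiply two terms, and then only the index equal to the
  degree of the first can contribute.\<close>

lemma homogeneous_component_mult:
  fixes f g :: "('v, 'k::comm_ring_1) mpoly"
  shows "homogeneous_component d (f * g) = (\<Sum>i\<le>d. homogeneous_component i f * homogeneous_component (d - i) g)"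
proof (induction f rule: poly_mapping_single_induct)
  case (single a c)
  show ?case
  proof (induction g rule: poly_mapping_single_induct)
    case (single b e)
    have "(\<Sum>i\<le>d. homogeneous_component i (Poly_Mapping.single a c) * homogeneous_component (d - i) (Poly_Mapping.single b e))
      = (\<Sum>i\<le>d. if i = exponent_degree a then
            (if exponent_degree b = d - exponent_degree a then Poly_Mapping.single (a + b) (c * e) else 0) else 0)"
      by (intro sum.cong) (auto simp: homogeneous_component_single mult_single)
    also have "\<dots> = homogeneous_component d (Poly_Mapping.single a c * Poly_Mapping.single b e)"
      by (auto simp: mult_single homogeneous_component_single exponent_degree_add)
    finally show ?case by simp
  qed (simp_all add: distrib_left homogeneous_component_add sum.distrib)
qed (simp_all add: distrib_right homogeneous_component_add sum.distrib)

lemma homogeneous_ideal_prod: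
  fixes K L :: "('v, 'k::comm_ring_1) mpoly set"
  assumes K: "homogeneous_ideal K" and L: "homogeneous_ideal L"
  shows "homogeneous_ideal (K \<cdot>\<^bsub>polynomial_ring\<^esub> L)"
  unfolding homogeneous_ideal_def
proof (intro conjI ballI allI)
  show id: "ideal (K \<cdot>\<^bsub>polynomial_ring\<^esub> L) polynomial_ring"
    using K L by (simp add: homogeneous_ideal_def ideal_prod_type_ideal)
  fix f d assume "f \<in> K \<cdot>\<^bsub>polynomial_ring\<^esub> L"
  then show "homogeneous_component d f \<in> K \<cdot>\<^bsub>polynomial_ring\<^esub> L"
  proof (induction rule: ideal_prod.induct)
    case (prod a b)
    have "homogeneous_component i a * homogeneous_component (d - i) b \<in> K \<cdot>\<^bsub>polynomial_ring\<^esub> L" for i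
      using ideal_prod.prod[of "homogeneous_component i a" K "homogeneous_component (d - i) b" L polynomial_ring]
        K L prod by (simp add: homogeneous_ideal_def)
    then show ?case
      by (simp add: homogeneous_component_mult ideal_typeD(7)[OF id])
  next
    case (sum a b)
    then show ?case using ideal_typeD(2)[OF id] by (simp add: homogeneous_component_add)
  qed
qed

lemma homogeneous_ideal_power:
  "homogeneous_ideal K \<Longrightarrow> homogeneous_ideal (ideal_power polynomial_ring K s)"
proof (induction s)
  case 0
  then show ?case by (simp add: homogeneous_ideal_def ideal_type_iff)
qed (simp add: homogeneous_ideal_prod)

text \<open>Solve for the components of \<open>f\<close> one after another, from the lowest degree on: the constant
  term of \<open>u\<close> is invertible.\<close>

lemma homogeneous_ideal_cancel:
  fixes K :: "('v, 'k::field) mpoly set"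
  assumes K: "homogeneous_ideal K" and u: "Poly_Mapping.lookup u 0 \<noteq> 0" and uf: "u * f \<in> K"
  shows "f \<in> K"
proof -
  have id: "ideal K polynomial_ring" using K by (simp add: homogeneous_ideal_def)
  note D = ideal_typeD[OF id]
  define c where "c = Poly_Mapping.lookup u 0"
  have u0: "homogeneous_component 0 u = Poly_Mapping.single 0 c"
    by (rule poly_mapping_eqI) (auto simp: lookup_homogeneous_component lookup_single c_def when_def)
  have "homogeneous_component d f \<in> K" for d
  proof (induction d rule: less_induct)
    case (less d)
    \<comment> \<open>The summand for index 0 contains the unknown component; all others involve
      components of \<open>f\<close> of degree below \<open>d\<close>, already known to be in
      \<open>K\<close>.\<close>
    have eq: "homogeneous_component d (u * f) = Poly_Mapping.single 0 c * homogeneous_component d f +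
        (\<Sum>i\<in>{..d} - {0}. homogeneous_component i u * homogeneous_component (d - i) f)"
      by (simp add: homogeneous_component_mult sum.remove[of "{..d}" 0] u0)
    have "(\<Sum>i\<in>{..d} - {0}. homogeneous_component i u * homogeneous_component (d - i) f) \<in> K"
      by (rule D(7)) (auto intro!: D(3) less.IH)
    moreover have "homogeneous_component d (u * f) \<in> K"
      using K uf by (simp add: homogeneous_ideal_def)
    ultimately have "homogeneous_component d (u * f) -
        (\<Sum>i\<in>{..d} - {0}. homogeneous_component i u * homogeneous_component (d - i) f) \<in> K"
      by (intro D(6))
    then have "Poly_Mapping.single 0 c * homogeneous_component d f \<in> K"
      unfolding eq by (simp only: add_diff_cancel_right')
    then have "Poly_Mapping.single 0 (1 / c) * (Poly_Mapping.single 0 c * homogeneous_component d f) \<in> K"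
      by (rule D(3))
    then show ?case using u by (simp add: mult.assoc[symmetric] mult_single c_def)
  qed
  then have "(\<Sum>d\<in>exponent_degree ` Poly_Mapping.keys f. homogeneous_component d f) \<in> K"
    by (intro D(7))
  then show ?thesis by (simp add: sum_homogeneous_component)
qed

section \<open>The graded maximal ideal and its square\<close>

lemma single_mem_variable_multiple:
  fixes e :: "'v \<Rightarrow>\<^sub>0 nat"
  assumes "Poly_Mapping.lookup e i \<noteq> 0"
  shows "Poly_Mapping.single e (c :: 'k::comm_ring_1) = Poly_Mapping.single (e - Poly_Mapping.single i 1) c * variable i"
proof -
  have "e - Poly_Mapping.single i 1 + Poly_Mapping.single i 1 = e"
    using assms by (intro poly_mapping_eqI) (auto simp: lookup_add lookup_minus lookup_single when_def)
  then show ?thesis by (simp add: variable_def mult_single)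
qed

lemma lookup_mult_0:
  fixes f g :: "('v, 'k::comm_ring_1) mpoly"
  shows "Poly_Mapping.lookup (f * g) 0 = Poly_Mapping.lookup f 0 * Poly_Mapping.lookup g 0"
proof (induction f rule: poly_mapping_single_induct)
  case (single a c)
  have "a + b = 0 \<longleftrightarrow> a = 0 \<and> b = 0" for b
    using exponent_degree_eq_0_iff exponent_degree_add by (metis add_is_0)
  then show ?case
    by (induction g rule: poly_mapping_single_induct)
      (auto simp: mult_single lookup_single when_def distrib_left lookup_add)
qed (simp_all add: distrib_right lookup_add)

text \<open>The constant term is multiplicative and vanishes on the variables; conversely, every
  nonconstant monomial is divisible by a variable.\<close>

lemma graded_max_ideal_eq:
  "graded_max_ideal = {f :: ('v, 'k::comm_ring_1) mpoly. Poly_Mapping.lookup f 0 = 0}" (is "_ = ?M")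
proof
  have "Poly_Mapping.lookup (variable i :: ('v, 'k) mpoly) 0 = 0" for i
  proof -
    have "Poly_Mapping.single i (1::nat) \<noteq> 0" for i :: 'v
      by (metis exponent_degree_eq_0_iff exponent_degree_single zero_neq_one)
    then show ?thesis by (simp add: variable_def lookup_single when_def)
  qed
  then show "graded_max_ideal \<subseteq> ?M"
    unfolding graded_max_ideal_def
    by (intro genideal_type_minimal) (auto simp: ideal_type_iff lookup_add lookup_mult_0)
  show "?M \<subseteq> graded_max_ideal"
  proof
    fix f assume f: "f \<in> ?M"
    have "Poly_Mapping.single e (Poly_Mapping.lookup f e) \<in> graded_max_ideal" if "e \<in> Poly_Mapping.keys f" for e
    proof -
      have "e \<noteq> 0" using f that by (auto simp: in_keys_iff)
      then obtain i where "Poly_Mapping.lookup e i \<noteq> 0" by (metis lookup_zero poly_mapping_eqI)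
      then show ?thesis
        using single_mem_variable_multiple[of e i "Poly_Mapping.lookup f e"]
          ideal_typeD(3)[OF genideal_type_ideal] genideal_type_self
        unfolding graded_max_ideal_def by (metis rangeI subsetD)
    qed
    then have "(\<Sum>e\<in>Poly_Mapping.keys f. Poly_Mapping.single e (Poly_Mapping.lookup f e)) \<in> graded_max_ideal"
      unfolding graded_max_ideal_def by (intro ideal_typeD(7)[OF genideal_type_ideal])
    then show "f \<in> graded_max_ideal" by (simp add: poly_mapping_sum_single)
  qed
qed

lemma ideal_graded_max_ideal: "ideal graded_max_ideal polynomial_ring"
  unfolding graded_max_ideal_def by (rule genideal_type_ideal)

lemma variable_mem_graded_max_ideal: "(variable i :: ('v, 'k::comm_ring_1) mpoly) \<in> graded_max_ideal"
  unfolding graded_max_ideal_def by (intro subsetD[OF genideal_type_self] rangeI)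

lemma primeideal_graded_max_ideal:
  "primeideal (graded_max_ideal :: ('v, 'k::field) mpoly set) polynomial_ring"
  unfolding primeideal_type_iff using ideal_graded_max_ideal
  by (auto simp: graded_max_ideal_eq lookup_mult_0)

lemma ideal_power_2:
  assumes "ideal K (ring_of_type_algebra :: 'a::comm_ring_1 ring)"
  shows "ideal_power ring_of_type_algebra K 2 = K \<cdot>\<^bsub>ring_of_type_algebra\<^esub> K"
proof -
  interpret cring "ring_of_type_algebra :: 'a ring" by (rule cring_from_type_algebra)
  show ?thesis
    using ideal_prod_commute[OF assms oneideal] ideal_prod_one[OF assms]
    by (simp add: numeral_2_eq_2)
qed

text \<open>Polynomials all of whose monomials have degree at least 2 form an ideal, and it contains
  every product of two polynomials without constant term.\<close>

lemma graded_max_ideal_square_degree: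
  assumes f: "f \<in> ideal_power polynomial_ring (graded_max_ideal :: ('v, 'k::comm_ring_1) mpoly set) 2"
    and e: "e \<in> Poly_Mapping.keys f"
  shows "2 \<le> exponent_degree e"
proof -
  let ?D = "{f :: ('v, 'k) mpoly. \<forall>e\<in>Poly_Mapping.keys f. 2 \<le> exponent_degree e}"
  have id: "ideal ?D polynomial_ring"
    unfolding ideal_type_iff
  proof (intro conjI ballI allI)
    show "a + b \<in> ?D" if "a \<in> ?D" "b \<in> ?D" for a b
      using that Poly_Mapping.keys_add[of a b] by auto
    show "x * a \<in> ?D" if "a \<in> ?D" for x a
      using that keys_mult[of x a] by (fastforce simp: exponent_degree_add)
  qed simp
  have "graded_max_ideal \<cdot>\<^bsub>polynomial_ring\<^esub> graded_max_ideal \<subseteq> ?D"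
    unfolding ideal_prod_type_subset_iff[OF id]
  proof (intro ballI CollectI)
    fix a b :: "('v, 'k) mpoly" and e
    assume ab: "a \<in> graded_max_ideal" "b \<in> graded_max_ideal" and "e \<in> Poly_Mapping.keys (a * b)"
    then obtain a' b' where "e = a' + b'" "a' \<in> Poly_Mapping.keys a" "b' \<in> Poly_Mapping.keys b"
      using keys_mult[of a b] by blast
    moreover from this ab have "a' \<noteq> 0" "b' \<noteq> 0" by (auto simp: graded_max_ideal_eq in_keys_iff)
    then have "0 < exponent_degree a'" "0 < exponent_degree b'"
      by (simp_all add: zero_less_iff_neq_zero)
    ultimately show "2 \<le> exponent_degree e" by (simp add: exponent_degree_add)
  qed
  then show ?thesis
    using f e ideal_power_2[OF ideal_graded_max_ideal] by blast
qed

section \<open>Fiber products\<close>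

text \<open>For the roles of the two factors to be interchangeable, the variables are split along two
  injections instead of \<open>Inl\<close> and \<open>Inr\<close>.\<close>

locale variable_split =
  fixes \<phi> :: "'m \<Rightarrow> 'v" and \<psi> :: "'n \<Rightarrow> 'v"
  assumes inj_left: "inj \<phi>" and inj_right: "inj \<psi>"
    and disjoint: "range \<phi> \<inter> range \<psi> = {}" and cover: "range \<phi> \<union> range \<psi> = UNIV"
begin

abbreviation ext_left :: "('m, 'k::comm_ring_1) mpoly set \<Rightarrow> ('v, 'k) mpoly set" where
  "ext_left I \<equiv> Idl\<^bsub>polynomial_ring\<^esub> (rename \<phi> ` I)"

abbreviation ext_right :: "('n, 'k::comm_ring_1) mpoly set \<Rightarrow> ('v, 'k) mpoly set" where
  "ext_right J \<equiv> Idl\<^bsub>polynomial_ring\<^esub> (rename \<psi> ` J)"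

lemma variable_split_swap: "variable_split \<psi> \<phi>"
  using inj_left inj_right disjoint cover by unfold_locales auto

lemma range_rename_exponent_Int:
  assumes "e \<in> range (rename_exponent \<phi>)" "e \<in> range (rename_exponent \<psi>)"
  shows "e = 0"
proof -
  have "Poly_Mapping.keys e \<subseteq> range \<phi> \<inter> range \<psi>"
    using assms by (simp add: range_rename_exponent_iff inj_left inj_right)
  then show ?thesis
    unfolding disjoint by (intro poly_mapping_eqI) (auto simp: in_keys_iff)
qed

lemma range_rename_exponent_other:
  assumes "e \<notin> range (rename_exponent \<phi>)"
  shows "\<exists>j. Poly_Mapping.lookup e (\<psi> j) \<noteq> 0"
proof -
  obtain k where "k \<in> Poly_Mapping.keys e" "k \<notin> range \<phi>"
    using assms by (auto simp: range_rename_exponent_iff[OF inj_left])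
  moreover from this cover have "k \<in> range \<psi>" by blast
  ultimately show ?thesis by (auto simp: in_keys_iff)
qed

lemma single_mem_ext_right_max:
  assumes "Poly_Mapping.lookup e (\<psi> j) \<noteq> 0"
  shows "Poly_Mapping.single e c \<in> ext_right graded_max_ideal"
proof -
  have "rename \<psi> (variable j) \<in> ext_right graded_max_ideal"
    using variable_mem_graded_max_ideal by (intro subsetD[OF genideal_type_self] imageI)
  then show ?thesis
    unfolding single_mem_variable_multiple[OF assms] rename_variable
    by (rule ideal_typeD(3)[OF genideal_type_ideal])
qed

text \<open>The zero exponent is the only one shared by both sets of variables, and \<open>g\<close>
  has no constant term.\<close>

lemma restrict_rename_other:
  assumes "Poly_Mapping.lookup g 0 = 0"
  shows "restrict_vars \<phi> (rename \<psi> g) = 0"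
proof (rule poly_mapping_eqI)
  fix e
  have "Poly_Mapping.lookup (rename \<psi> g) (rename_exponent \<phi> e) = 0"
  proof (cases "rename_exponent \<phi> e \<in> range (rename_exponent \<psi>)")
    case True
    then have "rename_exponent \<phi> e = 0" using range_rename_exponent_Int by blast
    then show ?thesis
      using lookup_rename[OF inj_right, of g 0] assms by simp
  qed (rule lookup_rename_other)
  then show "Poly_Mapping.lookup (restrict_vars \<phi> (rename \<psi> g)) e = Poly_Mapping.lookup 0 e"
    by (simp add: lookup_restrict_vars[OF inj_left])
qed

lemma ext_right_max_subset:
  assumes I: "ideal I polynomial_ring"
  shows "ext_right graded_max_ideal \<subseteq> {f :: ('v, 'k::comm_ring_1) mpoly. restrict_vars \<phi> f \<in> I}"
  using ideal_typeD(1)[OF I]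
  by (intro genideal_type_minimal ideal_restrict_vars_preimage[OF inj_left I])
    (auto simp: graded_max_ideal_eq restrict_rename_other)

text \<open>Identifies I + \<nn> as the preimage of \<open>I\<close> under the map killing the
  \<open>\<psi>\<close> variables: what remains of \<open>f\<close> after removing its pure
  \<open>\<phi>\<close> part has a \<open>\<psi>\<close> variable in every monomial.\<close>

lemma ext_left_plus_max:
  assumes I: "ideal I polynomial_ring"
  shows "ext_left I <+>\<^bsub>polynomial_ring\<^esub> ext_right graded_max_ideal =
    {f :: ('v, 'k::comm_ring_1) mpoly. restrict_vars \<phi> f \<in> I}"
proof
  let ?A = "{f :: ('v, 'k::comm_ring_1) mpoly. restrict_vars \<phi> f \<in> I}"
  note id = ideal_restrict_vars_preimage[OF inj_left I]
  have "ext_left I \<subseteq> ?A"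
    using id by (intro genideal_type_minimal) (auto simp: restrict_vars_rename[OF inj_left])
  then show "ext_left I <+>\<^bsub>polynomial_ring\<^esub> ext_right graded_max_ideal \<subseteq> ?A"
    by (intro set_add_type_subset[OF id] ext_right_max_subset[OF I])
  show "?A \<subseteq> ext_left I <+>\<^bsub>polynomial_ring\<^esub> ext_right graded_max_ideal"
  proof
    fix f assume "f \<in> ?A"
    then have 1: "rename \<phi> (restrict_vars \<phi> f) \<in> ext_left I"
      using genideal_type_self[of "rename \<phi> ` I"] by blast
    define g where "g = f - rename \<phi> (restrict_vars \<phi> f)"
    have "Poly_Mapping.single e (Poly_Mapping.lookup g e) \<in> ext_right graded_max_ideal"
      if "e \<in> Poly_Mapping.keys g" for e
    proof -
      have "e \<notin> range (rename_exponent \<phi>)"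
        using that by (auto simp: g_def in_keys_iff lookup_minus lookup_rename[OF inj_left]
            lookup_restrict_vars[OF inj_left])
      then show ?thesis
        using range_rename_exponent_other single_mem_ext_right_max by blast
    qed
    then have "(\<Sum>e\<in>Poly_Mapping.keys g. Poly_Mapping.single e (Poly_Mapping.lookup g e))
        \<in> ext_right graded_max_ideal"
      by (intro ideal_typeD(7)[OF genideal_type_ideal])
    then have "g \<in> ext_right graded_max_ideal" by (simp only: poly_mapping_sum_single)
    with 1 show "f \<in> ext_left I <+>\<^bsub>polynomial_ring\<^esub> ext_right graded_max_ideal"
      unfolding set_add_type_iff
      by (intro bexI[of _ "rename \<phi> (restrict_vars \<phi> f)"] bexI[of _ g]) (simp_all add: g_def)
  qed
qed

text \<open>The monomials of \<open>f\<close> are pure in \<open>\<phi>\<close>, pure in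
  \<open>\<psi>\<close> or mixed. The pure parts are controlled by the two restrictions, and mixed
  monomials lie in the product of the extended maximal ideals.\<close>

lemma fiber_product_eq:
  assumes I: "ideal I polynomial_ring" and J: "ideal J polynomial_ring"
    and Im: "I \<subseteq> graded_max_ideal" and Jm: "J \<subseteq> graded_max_ideal"
  shows "ext_left I <+>\<^bsub>polynomial_ring\<^esub> ext_right J <+>\<^bsub>polynomial_ring\<^esub>
      ext_left graded_max_ideal \<cdot>\<^bsub>polynomial_ring\<^esub> ext_right graded_max_ideal =
    {f :: ('v, 'k::comm_ring_1) mpoly. restrict_vars \<phi> f \<in> I \<and> restrict_vars \<psi> f \<in> J}" (is "?L = ?F")
proof
  interpret swap: variable_split \<psi> \<phi> by (rule variable_split_swap)
  have F: "ideal ?F polynomial_ring"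
    using ideal_restrict_vars_preimage[OF inj_left I] ideal_restrict_vars_preimage[OF inj_right J]
    by (simp add: ideal_type_iff)
  have "ext_left I \<subseteq> ?F"
    using Im ideal_typeD(1)[OF J]
    by (intro genideal_type_minimal[OF F])
      (auto simp: restrict_vars_rename[OF inj_left] swap.restrict_rename_other graded_max_ideal_eq)
  moreover have "ext_right J \<subseteq> ?F"
    using Jm ideal_typeD(1)[OF I]
    by (intro genideal_type_minimal[OF F])
      (auto simp: restrict_vars_rename[OF inj_right] restrict_rename_other graded_max_ideal_eq)
  moreover have "ext_left graded_max_ideal \<cdot>\<^bsub>polynomial_ring\<^esub> ext_right graded_max_ideal \<subseteq> ?F"
    unfolding ideal_prod_type_subset_iff[OF F]
  proof (intro ballI CollectI conjI)
    fix a b :: "('v, 'k) mpoly"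
    assume a: "a \<in> ext_left graded_max_ideal" and b: "b \<in> ext_right graded_max_ideal"
    show "restrict_vars \<phi> (a * b) \<in> I"
      using ext_right_max_subset[OF I] b ideal_typeD(3)[OF I]
      by (auto simp: restrict_vars_mult[OF inj_left])
    show "restrict_vars \<psi> (a * b) \<in> J"
      using swap.ext_right_max_subset[OF J] a ideal_typeD(4)[OF J]
      by (auto simp: restrict_vars_mult[OF inj_right])
  qed
  ultimately show "?L \<subseteq> ?F"
    by (intro set_add_type_subset[OF F])
  show "?F \<subseteq> ?L"
  proof
    fix f assume f: "f \<in> ?F"
    have 1: "rename \<phi> (restrict_vars \<phi> f) \<in> ext_left I"
      using f genideal_type_self[of "rename \<phi> ` I"] by blast
    have 2: "rename \<psi> (restrict_vars \<psi> f) \<in> ext_right J"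
      using f genideal_type_self[of "rename \<psi> ` J"] by blast
    have "Poly_Mapping.lookup (restrict_vars \<phi> f) 0 = 0"
      using f Im by (auto simp: graded_max_ideal_eq)
    \<comment> \<open>The constant term belongs to both pure parts and would be subtracted twice in
      \<open>g\<close>; it vanishes because \<open>I\<close> lies in the graded maximal
      ideal.\<close>
    then have f0: "Poly_Mapping.lookup f 0 = 0"
      by (simp add: lookup_restrict_vars[OF inj_left])
    define g where "g = f - rename \<phi> (restrict_vars \<phi> f) - rename \<psi> (restrict_vars \<psi> f)"
    have lookup_rr: "Poly_Mapping.lookup (rename \<chi> (restrict_vars \<chi> f)) e = Poly_Mapping.lookup f e"
      if "inj \<chi>" "e \<in> range (rename_exponent \<chi>)" for e and \<chi> :: "'x \<Rightarrow> 'v"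
      using that by (auto simp: lookup_rename lookup_restrict_vars)
    have "Poly_Mapping.single e (Poly_Mapping.lookup g e)
        \<in> ext_left graded_max_ideal \<cdot>\<^bsub>polynomial_ring\<^esub> ext_right graded_max_ideal"
      if e: "e \<in> Poly_Mapping.keys g" for e
    proof -
      have ne: "Poly_Mapping.lookup f e - Poly_Mapping.lookup (rename \<phi> (restrict_vars \<phi> f)) e
          - Poly_Mapping.lookup (rename \<psi> (restrict_vars \<psi> f)) e \<noteq> 0"
        using e by (simp add: g_def in_keys_iff lookup_minus)
      have "e \<notin> range (rename_exponent \<phi>)"
      proof
        assume *: "e \<in> range (rename_exponent \<phi>)"
        show False
        proof (cases "e \<in> range (rename_exponent \<psi>)")
          case True
          then have "e = 0" using * range_rename_exponent_Int by blast
          then show False using ne f0 * True by (simp add: lookup_rr inj_left inj_right)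
        qed (use ne * in \<open>simp add: lookup_rr inj_left lookup_rename_other\<close>)
      qed
      moreover from this have "e \<notin> range (rename_exponent \<psi>)"
        using ne lookup_rr[OF inj_right, of e] lookup_rename_other[of e \<phi> "restrict_vars \<phi> f"] by auto
      ultimately obtain i j where i: "Poly_Mapping.lookup e (\<phi> i) \<noteq> 0" and j: "Poly_Mapping.lookup e (\<psi> j) \<noteq> 0"
        using range_rename_exponent_other swap.range_rename_exponent_other by blast
      \<comment> \<open>Splitting off the variable \<open>\<psi> j\<close> leaves the
        \<open>\<phi> i\<close> exponent untouched, so the cofactor is still in the left extended
        maximal ideal.\<close>
      have "\<psi> j \<noteq> \<phi> i" using disjoint by blast
      then have "Poly_Mapping.lookup (e - Poly_Mapping.single (\<psi> j) 1) (\<phi> i) \<noteq> 0"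
        using i by (simp add: lookup_minus lookup_single when_def)
      then have "Poly_Mapping.single (e - Poly_Mapping.single (\<psi> j) 1) (Poly_Mapping.lookup g e)
          \<in> ext_left graded_max_ideal"
        by (rule swap.single_mem_ext_right_max)
      moreover have "(variable (\<psi> j) :: ('v, 'k) mpoly) \<in> ext_right graded_max_ideal"
        unfolding variable_def by (rule single_mem_ext_right_max[of _ j]) (simp add: lookup_single)
      ultimately show ?thesis
        unfolding single_mem_variable_multiple[OF j, of "Poly_Mapping.lookup g e"]
        using ideal_prod.prod[where R = "polynomial_ring :: ('v, 'k) mpoly ring"] by simp
    qed
    then have "(\<Sum>e\<in>Poly_Mapping.keys g. Poly_Mapping.single e (Poly_Mapping.lookup g e))
        \<in> ext_left graded_max_ideal \<cdot>\<^bsub>polynomial_ring\<^esub> ext_right graded_max_ideal"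
      by (intro ideal_typeD(7)[OF ideal_prod_type_ideal[OF genideal_type_ideal genideal_type_ideal]])
    then have 3: "g \<in> ext_left graded_max_ideal \<cdot>\<^bsub>polynomial_ring\<^esub> ext_right graded_max_ideal"
      by (simp only: poly_mapping_sum_single)
    have "rename \<phi> (restrict_vars \<phi> f) + rename \<psi> (restrict_vars \<psi> f)
        \<in> ext_left I <+>\<^bsub>polynomial_ring\<^esub> ext_right J"
      using 1 2 unfolding set_add_type_iff by blast
    moreover have "f = rename \<phi> (restrict_vars \<phi> f) + rename \<psi> (restrict_vars \<psi> f) + g"
      by (simp add: g_def)
    ultimately show "f \<in> ?L"
      using 3 by (intro set_add_type_iff[THEN iffD2]) blast
  qed
qed

text \<open>The copy of \<open>a\<close> in the big ring restricts to 0 along \<open>\<psi>\<close>,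
  so it belongs to the preimage of \<open>J\<close>. Inside an associated prime (A : f) it would
  force the restriction of \<open>f\<close> into \<open>I\<close>, that is, 1 into the
  prime.\<close>

lemma not_subset_Ass_of_nonzerodivisor:
  fixes I :: "('m, 'k::comm_ring_1) mpoly set"
  assumes I: "ideal I polynomial_ring" and J: "ideal J polynomial_ring"
    and a: "a \<in> graded_max_ideal" "\<And>x. a * x \<in> I \<Longrightarrow> x \<in> I"
    and P: "P \<in> Ass polynomial_ring (quot_module polynomial_ring {f :: ('v, 'k) mpoly. restrict_vars \<phi> f \<in> I})"
  shows "\<not> {f. restrict_vars \<psi> f \<in> J} \<subseteq> P"
proof
  assume sub: "{f. restrict_vars \<psi> f \<in> J} \<subseteq> P"
  interpret swap: variable_split \<psi> \<phi> by (rule variable_split_swap)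
  obtain f where pr: "primeideal P polynomial_ring" and f: "P = {b. restrict_vars \<phi> (b * f) \<in> I}"
    using P by (auto simp: Ass_quot_module_type[OF ideal_restrict_vars_preimage[OF inj_left I]])
  have "restrict_vars \<psi> (rename \<phi> a) \<in> J"
    using a(1) ideal_typeD(1)[OF J] by (simp add: swap.restrict_rename_other graded_max_ideal_eq)
  then have "rename \<phi> a \<in> P" using sub by blast
  then have "a * restrict_vars \<phi> f \<in> I"
    by (simp add: f restrict_vars_mult[OF inj_left] restrict_vars_rename[OF inj_left])
  then have "1 \<in> P" using a(2) by (simp add: f)
  then show False using pr by (simp add: primeideal_type_iff)
qed

text \<open>The socle element \<open>f\<close> makes the graded maximal ideal an associated prime,
  and a multiplier outside that ideal has nonzero constant term and cancels from homogeneous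
  ideals.\<close>

lemma symbolic_power_fiber_product_of_socle:
  fixes I :: "('m, 'k::field) mpoly set" and J :: "('n, 'k) mpoly set"
  assumes I: "homogeneous_ideal I" and I2: "I \<subseteq> ideal_power polynomial_ring graded_max_ideal 2"
    and J: "homogeneous_ideal J"
    and f: "f \<notin> I" "\<And>a. a \<in> graded_max_ideal \<Longrightarrow> a * f \<in> I"
  shows "symbolic_power polynomial_ring {f. restrict_vars \<phi> f \<in> I \<and> restrict_vars \<psi> f \<in> J} s =
    ideal_power polynomial_ring {f. restrict_vars \<phi> f \<in> I \<and> restrict_vars \<psi> f \<in> J} s"
proof
  let ?F = "{f. restrict_vars \<phi> f \<in> I \<and> restrict_vars \<psi> f \<in> J}"
  interpret swap: variable_split \<psi> \<phi> by (rule variable_split_swap)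
  have idI: "ideal I polynomial_ring" and idJ: "ideal J polynomial_ring"
    using I J by (simp_all add: homogeneous_ideal_def)
  have F: "ideal ?F polynomial_ring"
    using ideal_restrict_vars_preimage[OF inj_left idI] ideal_restrict_vars_preimage[OF inj_right idJ]
    by (simp add: ideal_type_iff)
  \<comment> \<open>Restriction along an injection preserves degrees, so \<open>?F\<close> inherits
    homogeneity from \<open>I\<close> and \<open>J\<close>.\<close>
  have comp: "restrict_vars \<chi> (homogeneous_component d g) = homogeneous_component d (restrict_vars \<chi> g)"
    if "inj \<chi>" for \<chi> :: "'x \<Rightarrow> 'v" and d and g :: "('v, 'k) mpoly"
    by (rule poly_mapping_eqI)
      (simp add: lookup_restrict_vars lookup_homogeneous_component exponent_degree_rename that)
  have homF: "homogeneous_ideal ?F"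
    using F I J by (simp add: homogeneous_ideal_def comp inj_left inj_right)
  show "ideal_power polynomial_ring ?F s \<subseteq> symbolic_power polynomial_ring ?F s"
    by (rule ideal_power_subset_symbolic_power[OF F])
  \<comment> \<open>Otherwise, for any variable, its product with \<open>f\<close> would lie in
    \<open>I\<close> and have a monomial of degree 1, contrary to containment in the square. A
    variable exists because types are inhabited.\<close>
  have f0: "Poly_Mapping.lookup f 0 = 0"
  proof (rule ccontr)
    assume "Poly_Mapping.lookup f 0 \<noteq> 0"
    moreover fix i
    have "variable i * f \<in> ideal_power polynomial_ring graded_max_ideal 2"
      using I2 f(2)[OF variable_mem_graded_max_ideal] by blast
    ultimately show False
      using graded_max_ideal_square_degree[of "variable i * f" "Poly_Mapping.single i 1"]
        lookup_single_mult[of "Poly_Mapping.single i 1" 1 f 0]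
      by (simp add: variable_def in_keys_iff)
  qed
  \<comment> \<open>Killing \<open>f\<close> modulo \<open>I\<close> forces zero constant term,
    since a nonzero one could be cancelled to give \<open>f\<close> in \<open>I\<close>. Along
    \<open>\<psi>\<close> the product restricts to 0 because \<open>f\<close> has no constant
    term.\<close>
  have "{b. b * rename \<phi> f \<in> ?F} = graded_max_ideal"
  proof (intro equalityI subsetI)
    fix b :: "('v, 'k) mpoly" assume b: "b \<in> graded_max_ideal"
    have "restrict_vars \<phi> b \<in> graded_max_ideal"
      using b by (simp add: graded_max_ideal_eq lookup_restrict_vars[OF inj_left])
    then show "b \<in> {b. b * rename \<phi> f \<in> ?F}"
      using f(2) ideal_typeD(1)[OF idJ] f0
      by (simp add: restrict_vars_mult[OF inj_left] restrict_vars_mult[OF inj_right]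
          restrict_vars_rename[OF inj_left] swap.restrict_rename_other)
  next
    fix b :: "('v, 'k) mpoly" assume "b \<in> {b. b * rename \<phi> f \<in> ?F}"
    then have "restrict_vars \<phi> b * f \<in> I"
      by (simp add: restrict_vars_mult[OF inj_left] restrict_vars_rename[OF inj_left])
    then have "Poly_Mapping.lookup (restrict_vars \<phi> b) 0 = 0"
      using homogeneous_ideal_cancel[OF I, of "restrict_vars \<phi> b" f] f(1) by blast
    then show "b \<in> graded_max_ideal"
      by (simp add: graded_max_ideal_eq lookup_restrict_vars[OF inj_left])
  qed
  then have ass: "graded_max_ideal \<in> Ass polynomial_ring (quot_module polynomial_ring ?F)"
    using primeideal_graded_max_ideal by (auto simp: Ass_quot_module_type[OF F])
  show "symbolic_power polynomial_ring ?F s \<subseteq> ideal_power polynomial_ring ?F s"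
  proof
    fix g assume "g \<in> symbolic_power polynomial_ring ?F s"
    then obtain u where "u \<notin> graded_max_ideal" "u * g \<in> ideal_power polynomial_ring ?F s"
      using ass unfolding symbolic_power_type[OF F] by blast
    then show "g \<in> ideal_power polynomial_ring ?F s"
      using homogeneous_ideal_cancel[OF homogeneous_ideal_power[OF homF]]
      by (simp add: graded_max_ideal_eq)
  qed
qed

end

section \<open>The symbolic powers of the fiber product in the two depth cases\<close>

theorem lemma3p2:
  fixes I :: "('m::finite, 'k::field) mpoly set"
    and J :: "('n::finite, 'k) mpoly set"
    and R :: "('m, 'k) mpoly ring"
    and S :: "('n, 'k) mpoly ring"
    and T :: "('m + 'n, 'k) mpoly ring"
    and \<mm> :: "('m, 'k) mpoly set"
    and \<nn> :: "('n, 'k) mpoly set"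
    and F :: "('m + 'n, 'k) mpoly set"
  assumes "R = polynomial_ring" and "S = polynomial_ring" and "T = polynomial_ring"
    and "\<mm> = graded_max_ideal" and "\<nn> = graded_max_ideal"
    and "homogeneous_ideal I" and "I \<subseteq> ideal_power R \<mm> 2"
    and "homogeneous_ideal J" and "J \<subseteq> ideal_power S \<nn> 2"
    and "F = extend_left I <+>\<^bsub>T\<^esub> extend_right J <+>\<^bsub>T\<^esub>
             extend_left \<mm> \<cdot>\<^bsub>T\<^esub> extend_right \<nn>"
  shows "(min (depth R \<mm> (quot_module R I)) (depth S \<nn> (quot_module S J)) \<ge> 1 \<longrightarrow>
            (\<forall>s\<ge>1. symbolic_power T F s =
               symbolic_power T (extend_left I <+>\<^bsub>T\<^esub> extend_right \<nn>) s \<inter>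
               symbolic_power T (extend_right J <+>\<^bsub>T\<^esub> extend_left \<mm>) s)) \<and>
         (min (depth R \<mm> (quot_module R I)) (depth S \<nn> (quot_module S J)) = 0 \<longrightarrow>
            (\<forall>s\<ge>1. symbolic_power T F s = ideal_power T F s))"
proof -
  note RST [simp] = assms(1-5) and homI = assms(6) and I2 = assms(7)[simplified]
    and homJ = assms(8) and J2 = assms(9)[simplified]
  \<comment> \<open>The same splitting is interpreted in both orders, so that each one-sided lemma
    is available for either factor.\<close>
  interpret L: variable_split "Inl :: 'm \<Rightarrow> 'm + 'n" "Inr :: 'n \<Rightarrow> 'm + 'n"
    by unfold_locales (auto simp: UNIV_sum)
  interpret R: variable_split "Inr :: 'n \<Rightarrow> 'm + 'n" "Inl :: 'm \<Rightarrow> 'm + 'n"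
    by (rule L.variable_split_swap)
  have idI: "ideal I polynomial_ring" and idJ: "ideal J polynomial_ring"
    using homI homJ by (simp_all add: homogeneous_ideal_def)
  have square: "ideal_power polynomial_ring graded_max_ideal 2 \<subseteq> (graded_max_ideal :: ('x, 'k) mpoly set)"
    unfolding ideal_power_2[OF ideal_graded_max_ideal]
      ideal_prod_type_subset_iff[OF ideal_graded_max_ideal]
    using ideal_typeD(3)[OF ideal_graded_max_ideal] by blast
  have Im: "I \<subseteq> graded_max_ideal" and Jm: "J \<subseteq> graded_max_ideal"
    using I2 J2 square by blast+
  define A where "A = {f :: ('m + 'n, 'k) mpoly. restrict_vars Inl f \<in> I}"
  define B where "B = {f :: ('m + 'n, 'k) mpoly. restrict_vars Inr f \<in> J}"
  have A: "extend_left I <+>\<^bsub>polynomial_ring\<^esub> extend_right graded_max_ideal = A"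
    and B: "extend_right J <+>\<^bsub>polynomial_ring\<^esub> extend_left graded_max_ideal = B"
    unfolding extend_left_def extend_right_def A_def B_def
    by (rule L.ext_left_plus_max[OF idI], rule R.ext_left_plus_max[OF idJ])
  have F: "F = A \<inter> B" "F = {f. restrict_vars Inl f \<in> I \<and> restrict_vars Inr f \<in> J}"
    using L.fiber_product_eq[OF idI idJ Im Jm] assms(10)
    by (simp_all add: extend_left_def extend_right_def A_def B_def Collect_conj_eq)
  have idA: "ideal A polynomial_ring" and idB: "ideal B polynomial_ring"
    unfolding A_def B_def
    by (rule ideal_restrict_vars_preimage[OF inj_Inl idI], rule ideal_restrict_vars_preimage[OF inj_Inr idJ])
  have one: "1 \<notin> (graded_max_ideal :: ('x, 'k) mpoly set)"
    by (simp add: graded_max_ideal_eq)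
  show ?thesis
  proof (intro conjI impI allI)
    fix s :: nat
    assume depth: "1 \<le> min (depth R \<mm> (quot_module R I)) (depth S \<nn> (quot_module S J))"
    obtain a where a: "a \<in> graded_max_ideal" "\<And>x. a * x \<in> I \<Longrightarrow> x \<in> I"
      using depth depth_ge_1_imp_nonzerodivisor[OF idI, of graded_max_ideal] by auto
    obtain b where b: "b \<in> graded_max_ideal" "\<And>x. b * x \<in> J \<Longrightarrow> x \<in> J"
      using depth depth_ge_1_imp_nonzerodivisor[OF idJ, of graded_max_ideal] by auto
    have "symbolic_power polynomial_ring (A \<inter> B) s =
        symbolic_power polynomial_ring A s \<inter> symbolic_power polynomial_ring B s"
    proof (rule symbolic_power_Int[OF idA idB])
      show "\<not> B \<subseteq> P" if "P \<in> Ass polynomial_ring (quot_module polynomial_ring A)" for P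
        using L.not_subset_Ass_of_nonzerodivisor[OF idI idJ a] that unfolding A_def B_def by blast
      show "\<not> A \<subseteq> P" if "P \<in> Ass polynomial_ring (quot_module polynomial_ring B)" for P
        using R.not_subset_Ass_of_nonzerodivisor[OF idJ idI b] that unfolding A_def B_def by blast
    qed
    then show "symbolic_power T F s = symbolic_power T (extend_left I <+>\<^bsub>T\<^esub> extend_right \<nn>) s \<inter>
        symbolic_power T (extend_right J <+>\<^bsub>T\<^esub> extend_left \<mm>) s"
      by (simp add: A B F(1))
  next
    fix s :: nat
    assume "min (depth R \<mm> (quot_module R I)) (depth S \<nn> (quot_module S J)) = 0"
    then consider "depth R \<mm> (quot_module R I) = 0" | "depth S \<nn> (quot_module S J) = 0"
      by (metis min_def)
    then show "symbolic_power T F s = ideal_power T F s"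
    proof cases
      \<comment> \<open>Depth zero makes every element of the maximal ideal a zero divisor modulo
        \<open>I\<close>; noetherianity then supplies one \<open>f\<close> outside \<open>I\<close>
        that the whole maximal ideal multiplies into \<open>I\<close>.\<close>
      case 1
      then obtain f where "f \<notin> I" "\<And>a. a \<in> graded_max_ideal \<Longrightarrow> a * f \<in> I"
        using noetherian_zerodivisors_annihilator[OF hilbert_basis idI ideal_graded_max_ideal]
          depth_0_imp_zerodivisors[OF idI _ ideal_graded_max_ideal one Im] by auto
      from L.symbolic_power_fiber_product_of_socle[OF homI I2 homJ this] show ?thesis
        by (simp add: F(2))
    next
      case 2
      then obtain f where "f \<notin> J" "\<And>a. a \<in> graded_max_ideal \<Longrightarrow> a * f \<in> J"
        using noetherian_zerodivisors_annihilator[OF hilbert_basis idJ ideal_graded_max_ideal]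
          depth_0_imp_zerodivisors[OF idJ _ ideal_graded_max_ideal one Jm] by auto
      from R.symbolic_power_fiber_product_of_socle[OF homJ J2 homI this] show ?thesis
        by (simp add: F(2) conj_commute)
    qed
  qed
qed

end
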